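(* Let $(\psi(\tau_1,\tau_2))_{(\tau_1,\tau_2)\in\Theta\times\Theta}$ be a bi-admissible, $p$-integrable family. For $S\in\Theta$ set $$V(S)=\operatorname*{ess\,sup}_{(\tau_1,\tau_2)\in\Theta_S\times\Theta_S}\rho_{S,\tau_1\vee\tau_2}[\psi(\tau_1,\tau_2)],$$ and assume that $V(S)\in L^p$ for each $S\in\Theta$. For $S\in\Theta$ define $$v_1(S)=\operatorname*{ess\,sup}_{\tau_1\in\Theta_S}\rho_{S,\tau_1}[\psi(\tau_1,S)],\qquad v_2(S)=\operatorname*{ess\,sup}_{\tau_2\in\Theta_S}\rho_{S,\tau_2}[\psi(S,\tau_2)],$$ $$\phi(S)=v_1(S)\vee v_2(S),\qquad u(S)=\operatorname*{ess\,sup}_{\tau\in\Theta_S}\rho_{S,\tau}[\phi(\tau)].$$ Then for each $S\in\Theta$, $u(S)=V(S)$ a.s.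
   Context: Let $T>0$ be fixed and let $(\Omega,\mathcal F,P)$ be a complete probability space with a right-continuous complete filtration $(\mathcal F_t)_{t\in[0,T]}$. Equalities and inequalities between random variables, and equalities between measurable sets, are understood $P$-a.s. Let $(\theta_k)_{k\in\mathbb N}$ be a sequence of stopping times with $\theta_0=0$, $\theta_k\le\theta_{k+1}$ a.s. for all $k$, and $\lim_k\theta_k=T$ a.s. $\Theta$ (Bermudan stopping strategies) is the set of stopping times of the form $\tau=\sum_{k\ge0}\theta_k\mathbf 1_{A_k}+T\mathbf 1_{\bar A}$, where $\{(A_k)_{k\ge 0},\bar A\}$ is a partition of $\Omega$ with $A_k\in\mathcal F_{\theta_k}$ and $\bar A\in\mathcal F_T$. For $S\in\Theta$, $\Theta_S=\{\nu\in\Theta:\nu\ge S\text{ a.s.}\}$. Fix $p\in[1,+\infty]$. A family $\xi=(\xi(\tau))_{\tau\in\Theta}$ of real random variables is admissible if $\xi(\tau)$ is $\mathcal F_\tau$-measurable and $\xi(\tau)=\xi(\tau')$ a.s. on $\{\tau=\tau'\}$ for all $\tau,\tau'\in\Theta$; it is $p$-integrable if each $\xi(\tau)\in L^p$. A family $(\psi(\tau_1,\tau_2))_{(\tau_1,\tau_2)\in\Theta\times\Theta}$ is bi-admissible if $\psi(\tau_1,\tau_2)$ is $\mathcal F_{\tau_1\vee\tau_2}$-measurable and $\psi(\tau_1,\tau_2)=\psi(\tilde\tau_1,\tilde\tau_2)$ on $\{\tau_1=\tilde\tau_1\}\cap\{\tau_2=\tilde\tau_2\}$; it is $p$-integrable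 if each $\psi(\tau_1,\tau_2)\in L^p$. The operators $\rho_{S,\tau}$, $S,\tau\in\Theta$, satisfy: (i) $\rho_{S,\tau}:L^p(\mathcal F_\tau)\to L^p(\mathcal F_S)$. (ii) (admissibility) $\rho_{S,\tau}[\eta]=\rho_{S',\tau}[\eta]$ a.s. on $\{S=S'\}$. (iii) (knowledge preservation) $\rho_{\tau,S}[\eta]=\eta$ for all $\eta\in L^p(\mathcal F_S)$, $\tau\in\Theta_S$. (iv) (monotonicity) $\rho_{S,\tau}[\eta_1]\le\rho_{S,\tau}[\eta_2]$ if $\eta_1\le\eta_2$ a.s. (v) (consistency) $\rho_{S,\theta}[\rho_{\theta,\tau}[\eta]]=\rho_{S,\tau}[\eta]$ for $S\le\theta\le\tau$ in $\Theta$, $\eta\in L^p(\mathcal F_\tau)$. (vi) (generalized zero-one law) $\mathbf 1_A\rho_{S,\tau}[\xi(\tau)]=\mathbf 1_A\rho_{S,\tau'}[\xi(\tau')]$ for every admissible $p$-integrable family $\xi$, $A\in\mathcal F_S$, $\tau,\tau'\in\Theta_S$ with $\tau=\tau'$ on $A$. (vi bis) For every bi-admissible $p$-integrable family $\psi$ and all Bermudan stopping times: $\mathbf 1_{\{\tau_1=\tau_1'\}}\rho_{\tau_1,\tau_1\vee\tau_2}[\psi(\tau_1,\tau_2)]=\mathbf 1_{\{\tau_1=\tau_1'\}}\rho_{\tau_1',\tau_1'\vee\tau_2}[\psi(\tau_1',\tau_2)]$ and $\mathbf 1_{\{\tau_2=\tau_2'\}}\rho_{\tau_2,\tau_1\vee\tau_2}[\psi(\tau_1,\tau_2)]=\mathbf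 1_{\{\tau_2=\tau_2'\}}\rho_{\tau_2',\tau_1\vee\tau_2'}[\psi(\tau_1,\tau_2')]$. (vi ter) For every bi-admissible $p$-integrable family $\psi$, all $\tau_1,\tau_2\in\Theta$ and $A\in\mathcal F_{\tau_1\wedge\tau_2}$ such that $\tau_1\wedge\tau_2=\tau_1$ and $\tau_1\vee\tau_2=\tau_2$ a.s. on $A$: $\mathbf 1_A\rho_{\tau_1\wedge\tau_2,\tau_1\vee\tau_2}[\psi(\tau_1\wedge\tau_2,\tau_1\vee\tau_2)]=\mathbf 1_A\rho_{\tau_1\wedge\tau_2,\tau_1\vee\tau_2}[\psi(\tau_1,\tau_2)]=\mathbf 1_A\rho_{\tau_1,\tau_1\vee\tau_2}[\psi(\tau_1,\tau_2)]$, and $\mathbf 1_A\rho_{\tau_1\wedge\tau_2,\tau_1\vee\tau_2}[\psi(\tau_1\vee\tau_2,\tau_1\wedge\tau_2)]=\mathbf 1_A\rho_{\tau_1\wedge\tau_2,\tau_1\vee\tau_2}[\psi(\tau_2,\tau_1)]=\mathbf 1_A\rho_{\tau_1,\tau_1\vee\tau_2}[\psi(\tau_2,\tau_1)]$. (vii) (monotone Fatou property) $\rho_{S,\tau}[\eta]\le\liminf_n\rho_{S,\tau}[\eta_n]$ whenever $(\eta_n)\subset L^p(\mathcal F_\tau)$ is non-decreasing, $\sup_n\eta_n\in L^p$ and $\eta_n\uparrow\eta$ a.s. *)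

theory Defs
  imports "HOL-Probability.Probability"
begin

section \<open>Essential supremum of a family of random variables\<close>

text \<open>\<^const>\<open>esssup\<close> is the essential supremum of a single function. The
  essential supremum of a family, which need not be countable, is its least upper bound for the
  order \<open>\<le>\<close> a.s. It takes values in \<^typ>\<open>ereal\<close> and is determined up to null sets.\<close>

definition is_ess_sup :: "'a measure \<Rightarrow> ('a \<Rightarrow> real) set \<Rightarrow> ('a \<Rightarrow> ereal) \<Rightarrow> bool"
  where "is_ess_sup M X Z \<longleftrightarrow>
    Z \<in> borel_measurable M \<and>
    (\<forall>x\<in>X. AE \<omega> in M. ereal (x \<omega>) \<le> Z \<omega>) \<and>
    (\<forall>Z'\<in>borel_measurable M. (\<forall>x\<in>X. AE \<omega> in M. ereal (x \<omega>) \<le> Z' \<omega>) \<longrightarrow>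
       (AE \<omega> in M. Z \<omega> \<le> Z' \<omega>))"

definition ess_sup :: "'a measure \<Rightarrow> ('a \<Rightarrow> real) set \<Rightarrow> 'a \<Rightarrow> ereal"
  where "ess_sup M X = (SOME Z. is_ess_sup M X Z)"

lemma (in finite_measure) ess_union:
  assumes "\<And>x. x \<in> X \<Longrightarrow> f x \<in> sets M"
  obtains C where "countable C" "C \<subseteq> X" "\<And>x. x \<in> X \<Longrightarrow> f x - (\<Union>c\<in>C. f c) \<in> null_sets M"
proof -
  define I where "I = {C. countable C \<and> C \<subseteq> X}"
  define m where "m C = measure M (\<Union>c\<in>C. f c)" for C
  have I_sets: "(\<Union>c\<in>C. f c) \<in> sets M" if "C \<in> I" for C
    using that assms unfolding I_def by (intro sets.countable_UN') auto
  have bdd: "bdd_above (m ` I)"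
    by (intro bdd_aboveI[of _ "measure M (space M)"]) (auto simp: m_def bounded_measure)
  have ne: "I \<noteq> {}"
    by (auto simp: I_def)
  have "\<exists>C\<in>I. (SUP C\<in>I. m C) - 1 / Suc n < m C" for n
    using less_cSUP_iff[OF ne bdd, of "(SUP C\<in>I. m C) - 1 / Suc n"] by simp
  then obtain c where c: "\<And>n. c n \<in> I" "\<And>n. (SUP C\<in>I. m C) - 1 / Suc n < m (c n)"
    by metis
  define C where "C = (\<Union>n. c n)"
  have C: "C \<in> I"
    using c(1) by (auto simp: C_def I_def)
  have "f x - (\<Union>c\<in>C. f c) \<in> null_sets M" if x: "x \<in> X" for x
  proof -
    let ?U = "\<Union>c\<in>C. f c"
    have xC: "insert x C \<in> I"
      using C x by (auto simp: I_def)
    have meas: "?U \<in> sets M" "f x - ?U \<in> sets M"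
      using I_sets[OF C] assms[OF x] by auto
    have "m (insert x C) = measure M (?U \<union> (f x - ?U))"
      unfolding m_def by (rule arg_cong[where f = "measure M"]) auto
    also have "\<dots> = m C + measure M (f x - ?U)"
      unfolding m_def using meas by (intro finite_measure_Union) auto
    finally have "m C + measure M (f x - ?U) \<le> (SUP C\<in>I. m C)"
      using cSUP_upper[OF xC bdd] by simp
    moreover have "m (c n) \<le> m C" for n
      unfolding m_def using I_sets[OF C]
      by (intro finite_measure_mono) (auto simp: C_def)
    ultimately have "measure M (f x - ?U) < 1 / Suc n" for n
      using c(2)[of n] by (smt (verit))
    then have "measure M (f x - ?U) \<le> 0"
      by (metis not_le nat_approx_posE not_less_iff_gr_or_eq)
    then show ?thesis
      using meas by (auto simp: null_sets_def emeasure_eq_measure measure_le_0_iff)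
  qed
  with C show thesis
    by (intro that[of C]) (auto simp: I_def)
qed

lemma (in finite_measure) is_ess_sup_ess_sup:
  assumes X: "X \<subseteq> borel_measurable M"
  shows "is_ess_sup M X (ess_sup M X)"
proof -
  define L where "L q x = {\<omega>\<in>space M. real_of_rat q < x \<omega>}" for q and x :: "'a \<Rightarrow> real"
  have L: "L q x \<in> sets M" if "x \<in> X" for q x
    using that X unfolding L_def by (auto intro!: borel_measurable_less)
  have "\<forall>q. \<exists>C. countable C \<and> C \<subseteq> X \<and> (\<forall>x\<in>X. L q x - (\<Union>c\<in>C. L q c) \<in> null_sets M)"
  proof
    fix q
    obtain C where "countable C" "C \<subseteq> X" "\<And>x. x \<in> X \<Longrightarrow> L q x - (\<Union>c\<in>C. L q c) \<in> null_sets M"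
      using ess_union[of X "L q", OF L] by blast
    then show "\<exists>C. countable C \<and> C \<subseteq> X \<and> (\<forall>x\<in>X. L q x - (\<Union>c\<in>C. L q c) \<in> null_sets M)"
      by blast
  qed
  then obtain C where *: "\<forall>q. countable (C q) \<and> C q \<subseteq> X \<and>
      (\<forall>x\<in>X. L q x - (\<Union>c\<in>C q. L q c) \<in> null_sets M)"
    by (rule exE[OF choice])
  have C: "countable (C q)" "C q \<subseteq> X" "x \<in> X \<Longrightarrow> L q x - (\<Union>c\<in>C q. L q c) \<in> null_sets M" for q x
    using spec[OF *, of q] by simp_all
  define D where "D = (\<Union>q. C q)"
  have D: "countable D" "D \<subseteq> X"
    using C by (auto simp: D_def)
  define Z where "Z \<omega> = (SUP x\<in>D. ereal (x \<omega>))" for \<omega>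
  have "Z \<in> borel_measurable M"
    unfolding Z_def using D X by (intro borel_measurable_SUP) auto
  moreover have "AE \<omega> in M. ereal (x \<omega>) \<le> Z \<omega>" if x: "x \<in> X" for x
  proof -
    have "AE \<omega> in M. \<forall>q. \<omega> \<notin> L q x - (\<Union>c\<in>C q. L q c)"
      unfolding AE_all_countable using C(3)[OF x] by (intro allI AE_not_in) auto
    with AE_space show ?thesis
    proof eventually_elim
      case (elim \<omega>)
      show ?case
      proof (rule ccontr)
        assume "\<not> ereal (x \<omega>) \<le> Z \<omega>"
        then obtain r where r: "Z \<omega> < ereal r" "r < x \<omega>"
          using ereal_dense2[of "Z \<omega>" "ereal (x \<omega>)"] by (auto simp: not_le)
        obtain q where q: "r < of_rat q" "of_rat q < x \<omega>"
          using of_rat_dense[OF r(2)] by auto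
        then obtain c where c: "c \<in> C q" "of_rat q < c \<omega>"
          using elim by (auto simp: L_def)
        then have "ereal (c \<omega>) \<le> Z \<omega>"
          unfolding Z_def by (intro SUP_upper) (auto simp: D_def)
        with r(1) q(1) c(2) show False
          by (meson ereal_less(2) less_ereal.simps(1) less_trans not_le)
      qed
    qed
  qed
  moreover have "AE \<omega> in M. Z \<omega> \<le> Z' \<omega>"
    if "\<forall>x\<in>X. AE \<omega> in M. ereal (x \<omega>) \<le> Z' \<omega>" for Z'
  proof -
    have "AE \<omega> in M. \<forall>x\<in>D. ereal (x \<omega>) \<le> Z' \<omega>"
      using that D by (intro AE_ball_countable[THEN iffD2]) auto
    then show ?thesis
      by eventually_elim (auto simp: Z_def intro: SUP_least)
  qed
  ultimately have "is_ess_sup M X Z"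
    by (auto simp: is_ess_sup_def)
  then show ?thesis
    unfolding ess_sup_def by (rule someI[of "is_ess_sup M X"])
qed


section \<open>The spaces \<open>L\<^sup>p\<close> and stopped sigma-algebras\<close>

text \<open>Elements of \<open>L\<^sup>p(G)\<close>, for a sub-sigma-algebra \<open>G\<close> of \<open>M\<close>, are represented by functions;
  only the sets of \<open>G\<close> matter, the measure is that of \<open>M\<close>.\<close>

definition Lp :: "'a measure \<Rightarrow> ennreal \<Rightarrow> 'a measure \<Rightarrow> ('a \<Rightarrow> real) set"
  where "Lp M p G = {f \<in> borel_measurable G.
    if p = \<infinity> then esssup M (\<lambda>\<omega>. ereal \<bar>f \<omega>\<bar>) < \<infinity>
    else integrable M (\<lambda>\<omega>. \<bar>f \<omega>\<bar> powr enn2real p)}"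

abbreviation tmax :: "('a \<Rightarrow> real) \<Rightarrow> ('a \<Rightarrow> real) \<Rightarrow> 'a \<Rightarrow> real" (infixl "\<squnion>\<^sub>t" 65)
  where "\<tau>\<^sub>1 \<squnion>\<^sub>t \<tau>\<^sub>2 \<equiv> (\<lambda>\<omega>. max (\<tau>\<^sub>1 \<omega>) (\<tau>\<^sub>2 \<omega>))"

abbreviation tmin :: "('a \<Rightarrow> real) \<Rightarrow> ('a \<Rightarrow> real) \<Rightarrow> 'a \<Rightarrow> real" (infixl "\<sqinter>\<^sub>t" 70)
  where "\<tau>\<^sub>1 \<sqinter>\<^sub>t \<tau>\<^sub>2 \<equiv> (\<lambda>\<omega>. min (\<tau>\<^sub>1 \<omega>) (\<tau>\<^sub>2 \<omega>))"

text \<open>The sigma-algebra \<open>\<F>\<^sub>\<tau>\<close>.\<close>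

abbreviation stopped :: "'a measure \<Rightarrow> (real \<Rightarrow> 'a measure) \<Rightarrow> ('a \<Rightarrow> real) \<Rightarrow> 'a measure"
  where "stopped M F \<tau> \<equiv> filtration.pre_sigma (space M) F \<tau>"

text \<open>Stopping times with values in \<open>[0, T]\<close>. For these, \<^const>\<open>stopping_time\<close> and \<^const>\<open>stopped\<close>
  depend on the filtration \<open>F\<close> only through \<open>F t\<close> with \<open>0 \<le> t \<le> T\<close>.\<close>

definition stopping_times :: "'a measure \<Rightarrow> (real \<Rightarrow> 'a measure) \<Rightarrow> real \<Rightarrow> ('a \<Rightarrow> real) set"
  where "stopping_times M F T = {\<tau>. stopping_time F \<tau> \<and> (\<forall>\<omega>\<in>space M. 0 \<le> \<tau> \<omega> \<and> \<tau> \<omega> \<le> T)}"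


section \<open>Bermudan stopping strategies and admissible families\<close>

text \<open>All identities between random variables are a.s. identities. In particular \<open>\<tau>\<close> is only
  required to coincide a.s. with the sum over the partition.\<close>

definition bermudan ::
  "'a measure \<Rightarrow> (real \<Rightarrow> 'a measure) \<Rightarrow> real \<Rightarrow> (nat \<Rightarrow> 'a \<Rightarrow> real) \<Rightarrow> ('a \<Rightarrow> real) set"
  where "bermudan M F T \<theta> = {\<tau> \<in> stopping_times M F T. \<exists>A B.
    (\<forall>k. A k \<in> sets (stopped M F (\<theta> k))) \<and> B \<in> sets (F T) \<and>
    disjoint_family A \<and> (\<Union>k. A k) \<inter> B = {} \<and> (\<Union>k. A k) \<union> B = space M \<and>
    (AE \<omega> in M. \<tau> \<omega> = (\<Sum>k. \<theta> k \<omega> * indicat_real (A k) \<omega>) + T * indicat_real B \<omega>)}"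

definition bermudan_from ::
  "'a measure \<Rightarrow> (real \<Rightarrow> 'a measure) \<Rightarrow> real \<Rightarrow> (nat \<Rightarrow> 'a \<Rightarrow> real) \<Rightarrow> ('a \<Rightarrow> real) \<Rightarrow> ('a \<Rightarrow> real) set"
  where "bermudan_from M F T \<theta> S = {\<nu> \<in> bermudan M F T \<theta>. AE \<omega> in M. S \<omega> \<le> \<nu> \<omega>}"

definition admissible ::
  "'a measure \<Rightarrow> (real \<Rightarrow> 'a measure) \<Rightarrow> real \<Rightarrow> (nat \<Rightarrow> 'a \<Rightarrow> real) \<Rightarrow>
   (('a \<Rightarrow> real) \<Rightarrow> 'a \<Rightarrow> real) \<Rightarrow> bool"
  where "admissible M F T \<theta> \<xi> \<longleftrightarrow>
    (\<forall>\<tau>\<in>bermudan M F T \<theta>. \<xi> \<tau> \<in> borel_measurable (stopped M F \<tau>)) \<and>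
    (\<forall>\<tau>\<in>bermudan M F T \<theta>. \<forall>\<tau>'\<in>bermudan M F T \<theta>. AE \<omega> in M. \<tau> \<omega> = \<tau>' \<omega> \<longrightarrow> \<xi> \<tau> \<omega> = \<xi> \<tau>' \<omega>)"

definition p_integrable ::
  "'a measure \<Rightarrow> (real \<Rightarrow> 'a measure) \<Rightarrow> real \<Rightarrow> (nat \<Rightarrow> 'a \<Rightarrow> real) \<Rightarrow> ennreal \<Rightarrow>
   (('a \<Rightarrow> real) \<Rightarrow> 'a \<Rightarrow> real) \<Rightarrow> bool"
  where "p_integrable M F T \<theta> p \<xi> \<longleftrightarrow> (\<forall>\<tau>\<in>bermudan M F T \<theta>. \<xi> \<tau> \<in> Lp M p M)"

definition bi_admissible ::
  "'a measure \<Rightarrow> (real \<Rightarrow> 'a measure) \<Rightarrow> real \<Rightarrow> (nat \<Rightarrow> 'a \<Rightarrow> real) \<Rightarrow>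
   (('a \<Rightarrow> real) \<Rightarrow> ('a \<Rightarrow> real) \<Rightarrow> 'a \<Rightarrow> real) \<Rightarrow> bool"
  where "bi_admissible M F T \<theta> \<psi> \<longleftrightarrow>
    (\<forall>\<tau>\<^sub>1\<in>bermudan M F T \<theta>. \<forall>\<tau>\<^sub>2\<in>bermudan M F T \<theta>.
       \<psi> \<tau>\<^sub>1 \<tau>\<^sub>2 \<in> borel_measurable (stopped M F (\<tau>\<^sub>1 \<squnion>\<^sub>t \<tau>\<^sub>2))) \<and>
    (\<forall>\<tau>\<^sub>1\<in>bermudan M F T \<theta>. \<forall>\<tau>\<^sub>2\<in>bermudan M F T \<theta>.
     \<forall>\<sigma>\<^sub>1\<in>bermudan M F T \<theta>. \<forall>\<sigma>\<^sub>2\<in>bermudan M F T \<theta>.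
       AE \<omega> in M. \<tau>\<^sub>1 \<omega> = \<sigma>\<^sub>1 \<omega> \<and> \<tau>\<^sub>2 \<omega> = \<sigma>\<^sub>2 \<omega> \<longrightarrow> \<psi> \<tau>\<^sub>1 \<tau>\<^sub>2 \<omega> = \<psi> \<sigma>\<^sub>1 \<sigma>\<^sub>2 \<omega>)"

definition bi_p_integrable ::
  "'a measure \<Rightarrow> (real \<Rightarrow> 'a measure) \<Rightarrow> real \<Rightarrow> (nat \<Rightarrow> 'a \<Rightarrow> real) \<Rightarrow> ennreal \<Rightarrow>
   (('a \<Rightarrow> real) \<Rightarrow> ('a \<Rightarrow> real) \<Rightarrow> 'a \<Rightarrow> real) \<Rightarrow> bool"
  where "bi_p_integrable M F T \<theta> p \<psi> \<longleftrightarrow>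
    (\<forall>\<tau>\<^sub>1\<in>bermudan M F T \<theta>. \<forall>\<tau>\<^sub>2\<in>bermudan M F T \<theta>. \<psi> \<tau>\<^sub>1 \<tau>\<^sub>2 \<in> Lp M p M)"


section \<open>Non-linear evaluation operators\<close>

text \<open>A filtration indexed by \<open>[0, T]\<close> is represented by one indexed by all reals, of which only
  the part over \<open>[0, T]\<close> is used; every filtration over \<open>[0, T]\<close> has such an extension,
  constant on both sides.\<close>

locale bermudan_setting =
  prob_space M + complete_measure M + filtration "space M" F
  for M :: "'a measure" and F :: "real \<Rightarrow> 'a measure" +
  fixes T :: real and \<theta> :: "nat \<Rightarrow> 'a \<Rightarrow> real"
  assumes T_pos: "0 < T"
    and F_sub: "sets (F T) \<subseteq> sets M"
    and F_complete: "null_sets M \<subseteq> sets (F 0)"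
    and F_right_cont: "\<And>t. 0 \<le> t \<Longrightarrow> t < T \<Longrightarrow> sets (F t) = (\<Inter>s\<in>{t<..T}. sets (F s))"
    and theta_stopping: "\<And>k. \<theta> k \<in> stopping_times M F T"
    and theta_0: "AE \<omega> in M. \<theta> 0 \<omega> = 0"
    and theta_mono: "\<And>k. AE \<omega> in M. \<theta> k \<omega> \<le> \<theta> (Suc k) \<omega>"
    and theta_lim: "AE \<omega> in M. (\<lambda>k. \<theta> k \<omega>) \<longlonglongrightarrow> T"

text \<open>\<open>\<rho> S \<tau>\<close> acts on representatives; by \<open>monotonicity\<close> it respects a.s. equality.
  An identity of the form \<open>1\<^sub>A X = 1\<^sub>A Y\<close> a.s. is written \<open>AE \<omega>. \<omega> \<in> A \<longrightarrow> X \<omega> = Y \<omega>\<close>.\<close>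

locale bermudan_evaluation = bermudan_setting M F T \<theta>
  for M :: "'a measure" and F T \<theta> +
  fixes p :: ennreal
    and \<rho> :: "('a \<Rightarrow> real) \<Rightarrow> ('a \<Rightarrow> real) \<Rightarrow> ('a \<Rightarrow> real) \<Rightarrow> 'a \<Rightarrow> real"
  assumes p_ge_1: "1 \<le> p"
    and rho_Lp: "\<And>S \<tau> \<eta>. S \<in> bermudan M F T \<theta> \<Longrightarrow> \<tau> \<in> bermudan M F T \<theta> \<Longrightarrow>
      \<eta> \<in> Lp M p (stopped M F \<tau>) \<Longrightarrow> \<rho> S \<tau> \<eta> \<in> Lp M p (stopped M F S)"
    and admissibility: "\<And>S S' \<tau> \<eta>. S \<in> bermudan M F T \<theta> \<Longrightarrow> S' \<in> bermudan M F T \<theta> \<Longrightarrow>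
      \<tau> \<in> bermudan M F T \<theta> \<Longrightarrow> \<eta> \<in> Lp M p (stopped M F \<tau>) \<Longrightarrow>
      AE \<omega> in M. S \<omega> = S' \<omega> \<longrightarrow> \<rho> S \<tau> \<eta> \<omega> = \<rho> S' \<tau> \<eta> \<omega>"
    and knowledge_preservation: "\<And>S \<tau> \<eta>. S \<in> bermudan M F T \<theta> \<Longrightarrow>
      \<tau> \<in> bermudan_from M F T \<theta> S \<Longrightarrow> \<eta> \<in> Lp M p (stopped M F S) \<Longrightarrow>
      AE \<omega> in M. \<rho> \<tau> S \<eta> \<omega> = \<eta> \<omega>"
    and monotonicity: "\<And>S \<tau> \<eta>\<^sub>1 \<eta>\<^sub>2. S \<in> bermudan M F T \<theta> \<Longrightarrow> \<tau> \<in> bermudan M F T \<theta> \<Longrightarrow>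
      \<eta>\<^sub>1 \<in> Lp M p (stopped M F \<tau>) \<Longrightarrow> \<eta>\<^sub>2 \<in> Lp M p (stopped M F \<tau>) \<Longrightarrow>
      AE \<omega> in M. \<eta>\<^sub>1 \<omega> \<le> \<eta>\<^sub>2 \<omega> \<Longrightarrow> AE \<omega> in M. \<rho> S \<tau> \<eta>\<^sub>1 \<omega> \<le> \<rho> S \<tau> \<eta>\<^sub>2 \<omega>"
    and consistency: "\<And>S \<sigma> \<tau> \<eta>. S \<in> bermudan M F T \<theta> \<Longrightarrow> \<sigma> \<in> bermudan M F T \<theta> \<Longrightarrow>
      \<tau> \<in> bermudan M F T \<theta> \<Longrightarrow> AE \<omega> in M. S \<omega> \<le> \<sigma> \<omega> \<Longrightarrow> AE \<omega> in M. \<sigma> \<omega> \<le> \<tau> \<omega> \<Longrightarrow>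
      \<eta> \<in> Lp M p (stopped M F \<tau>) \<Longrightarrow>
      AE \<omega> in M. \<rho> S \<sigma> (\<rho> \<sigma> \<tau> \<eta>) \<omega> = \<rho> S \<tau> \<eta> \<omega>"
    and zero_one: "\<And>\<xi> S \<tau> \<tau>' A. admissible M F T \<theta> \<xi> \<Longrightarrow> p_integrable M F T \<theta> p \<xi> \<Longrightarrow>
      S \<in> bermudan M F T \<theta> \<Longrightarrow> A \<in> sets (stopped M F S) \<Longrightarrow>
      \<tau> \<in> bermudan_from M F T \<theta> S \<Longrightarrow> \<tau>' \<in> bermudan_from M F T \<theta> S \<Longrightarrow>
      AE \<omega> in M. \<omega> \<in> A \<longrightarrow> \<tau> \<omega> = \<tau>' \<omega> \<Longrightarrow>
      AE \<omega> in M. \<omega> \<in> A \<longrightarrow> \<rho> S \<tau> (\<xi> \<tau>) \<omega> = \<rho> S \<tau>' (\<xi> \<tau>') \<omega>"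
    and zero_one_bis_1: "\<And>\<psi> \<tau>\<^sub>1 \<tau>\<^sub>1' \<tau>\<^sub>2. bi_admissible M F T \<theta> \<psi> \<Longrightarrow> bi_p_integrable M F T \<theta> p \<psi> \<Longrightarrow>
      \<tau>\<^sub>1 \<in> bermudan M F T \<theta> \<Longrightarrow> \<tau>\<^sub>1' \<in> bermudan M F T \<theta> \<Longrightarrow> \<tau>\<^sub>2 \<in> bermudan M F T \<theta> \<Longrightarrow>
      AE \<omega> in M. \<tau>\<^sub>1 \<omega> = \<tau>\<^sub>1' \<omega> \<longrightarrow>
        \<rho> \<tau>\<^sub>1 (\<tau>\<^sub>1 \<squnion>\<^sub>t \<tau>\<^sub>2) (\<psi> \<tau>\<^sub>1 \<tau>\<^sub>2) \<omega> = \<rho> \<tau>\<^sub>1' (\<tau>\<^sub>1' \<squnion>\<^sub>t \<tau>\<^sub>2) (\<psi> \<tau>\<^sub>1' \<tau>\<^sub>2) \<omega>"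
    and zero_one_bis_2: "\<And>\<psi> \<tau>\<^sub>1 \<tau>\<^sub>2 \<tau>\<^sub>2'. bi_admissible M F T \<theta> \<psi> \<Longrightarrow> bi_p_integrable M F T \<theta> p \<psi> \<Longrightarrow>
      \<tau>\<^sub>1 \<in> bermudan M F T \<theta> \<Longrightarrow> \<tau>\<^sub>2 \<in> bermudan M F T \<theta> \<Longrightarrow> \<tau>\<^sub>2' \<in> bermudan M F T \<theta> \<Longrightarrow>
      AE \<omega> in M. \<tau>\<^sub>2 \<omega> = \<tau>\<^sub>2' \<omega> \<longrightarrow>
        \<rho> \<tau>\<^sub>2 (\<tau>\<^sub>1 \<squnion>\<^sub>t \<tau>\<^sub>2) (\<psi> \<tau>\<^sub>1 \<tau>\<^sub>2) \<omega> = \<rho> \<tau>\<^sub>2' (\<tau>\<^sub>1 \<squnion>\<^sub>t \<tau>\<^sub>2') (\<psi> \<tau>\<^sub>1 \<tau>\<^sub>2') \<omega>"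
    and zero_one_ter: "\<And>\<psi> \<tau>\<^sub>1 \<tau>\<^sub>2 A. bi_admissible M F T \<theta> \<psi> \<Longrightarrow> bi_p_integrable M F T \<theta> p \<psi> \<Longrightarrow>
      \<tau>\<^sub>1 \<in> bermudan M F T \<theta> \<Longrightarrow> \<tau>\<^sub>2 \<in> bermudan M F T \<theta> \<Longrightarrow>
      A \<in> sets (stopped M F (\<tau>\<^sub>1 \<sqinter>\<^sub>t \<tau>\<^sub>2)) \<Longrightarrow>
      AE \<omega> in M. \<omega> \<in> A \<longrightarrow> (\<tau>\<^sub>1 \<sqinter>\<^sub>t \<tau>\<^sub>2) \<omega> = \<tau>\<^sub>1 \<omega> \<and> (\<tau>\<^sub>1 \<squnion>\<^sub>t \<tau>\<^sub>2) \<omega> = \<tau>\<^sub>2 \<omega> \<Longrightarrow>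
      AE \<omega> in M. \<omega> \<in> A \<longrightarrow>
        \<rho> (\<tau>\<^sub>1 \<sqinter>\<^sub>t \<tau>\<^sub>2) (\<tau>\<^sub>1 \<squnion>\<^sub>t \<tau>\<^sub>2) (\<psi> (\<tau>\<^sub>1 \<sqinter>\<^sub>t \<tau>\<^sub>2) (\<tau>\<^sub>1 \<squnion>\<^sub>t \<tau>\<^sub>2)) \<omega> =
          \<rho> (\<tau>\<^sub>1 \<sqinter>\<^sub>t \<tau>\<^sub>2) (\<tau>\<^sub>1 \<squnion>\<^sub>t \<tau>\<^sub>2) (\<psi> \<tau>\<^sub>1 \<tau>\<^sub>2) \<omega> \<and>
        \<rho> (\<tau>\<^sub>1 \<sqinter>\<^sub>t \<tau>\<^sub>2) (\<tau>\<^sub>1 \<squnion>\<^sub>t \<tau>\<^sub>2) (\<psi> \<tau>\<^sub>1 \<tau>\<^sub>2) \<omega> =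
          \<rho> \<tau>\<^sub>1 (\<tau>\<^sub>1 \<squnion>\<^sub>t \<tau>\<^sub>2) (\<psi> \<tau>\<^sub>1 \<tau>\<^sub>2) \<omega> \<and>
        \<rho> (\<tau>\<^sub>1 \<sqinter>\<^sub>t \<tau>\<^sub>2) (\<tau>\<^sub>1 \<squnion>\<^sub>t \<tau>\<^sub>2) (\<psi> (\<tau>\<^sub>1 \<squnion>\<^sub>t \<tau>\<^sub>2) (\<tau>\<^sub>1 \<sqinter>\<^sub>t \<tau>\<^sub>2)) \<omega> =
          \<rho> (\<tau>\<^sub>1 \<sqinter>\<^sub>t \<tau>\<^sub>2) (\<tau>\<^sub>1 \<squnion>\<^sub>t \<tau>\<^sub>2) (\<psi> \<tau>\<^sub>2 \<tau>\<^sub>1) \<omega> \<and>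
        \<rho> (\<tau>\<^sub>1 \<sqinter>\<^sub>t \<tau>\<^sub>2) (\<tau>\<^sub>1 \<squnion>\<^sub>t \<tau>\<^sub>2) (\<psi> \<tau>\<^sub>2 \<tau>\<^sub>1) \<omega> =
          \<rho> \<tau>\<^sub>1 (\<tau>\<^sub>1 \<squnion>\<^sub>t \<tau>\<^sub>2) (\<psi> \<tau>\<^sub>2 \<tau>\<^sub>1) \<omega>"
    \<comment> \<open>here \<open>\<eta>\<close> is a.s. the supremum of the \<open>\<eta>\<^sub>n\<close>, so that \<open>sup\<^sub>n \<eta>\<^sub>n \<in> L\<^sup>p\<close> is the assumption on \<open>\<eta>\<close>\<close>
    and monotone_fatou: "\<And>S \<tau> \<eta>s \<eta>. S \<in> bermudan M F T \<theta> \<Longrightarrow> \<tau> \<in> bermudan M F T \<theta> \<Longrightarrow>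
      (\<And>n. \<eta>s n \<in> Lp M p (stopped M F \<tau>)) \<Longrightarrow> \<eta> \<in> Lp M p (stopped M F \<tau>) \<Longrightarrow>
      AE \<omega> in M. incseq (\<lambda>n. \<eta>s n \<omega>) \<Longrightarrow> AE \<omega> in M. (\<lambda>n. \<eta>s n \<omega>) \<longlonglongrightarrow> \<eta> \<omega> \<Longrightarrow>
      AE \<omega> in M. ereal (\<rho> S \<tau> \<eta> \<omega>) \<le> liminf (\<lambda>n. ereal (\<rho> S \<tau> (\<eta>s n) \<omega>))"


section \<open>Value families of the double stopping problem\<close>

context
  fixes M :: "'a measure" and F :: "real \<Rightarrow> 'a measure" and T :: real
    and \<theta> :: "nat \<Rightarrow> 'a \<Rightarrow> real"
    and \<rho> :: "('a \<Rightarrow> real) \<Rightarrow> ('a \<Rightarrow> real) \<Rightarrow> ('a \<Rightarrow> real) \<Rightarrow> 'a \<Rightarrow> real"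
    and \<psi> :: "('a \<Rightarrow> real) \<Rightarrow> ('a \<Rightarrow> real) \<Rightarrow> 'a \<Rightarrow> real"
begin

definition double_value :: "('a \<Rightarrow> real) \<Rightarrow> 'a \<Rightarrow> ereal"
  where "double_value S = ess_sup M {\<rho> S (\<tau>\<^sub>1 \<squnion>\<^sub>t \<tau>\<^sub>2) (\<psi> \<tau>\<^sub>1 \<tau>\<^sub>2) | \<tau>\<^sub>1 \<tau>\<^sub>2.
    \<tau>\<^sub>1 \<in> bermudan_from M F T \<theta> S \<and> \<tau>\<^sub>2 \<in> bermudan_from M F T \<theta> S}"

definition value_1 :: "('a \<Rightarrow> real) \<Rightarrow> 'a \<Rightarrow> ereal"
  where "value_1 S = ess_sup M {\<rho> S \<tau>\<^sub>1 (\<psi> \<tau>\<^sub>1 S) | \<tau>\<^sub>1. \<tau>\<^sub>1 \<in> bermudan_from M F T \<theta> S}"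

definition value_2 :: "('a \<Rightarrow> real) \<Rightarrow> 'a \<Rightarrow> ereal"
  where "value_2 S = ess_sup M {\<rho> S \<tau>\<^sub>2 (\<psi> S \<tau>\<^sub>2) | \<tau>\<^sub>2. \<tau>\<^sub>2 \<in> bermudan_from M F T \<theta> S}"

definition new_reward :: "('a \<Rightarrow> real) \<Rightarrow> 'a \<Rightarrow> ereal"
  where "new_reward S \<omega> = max (value_1 S \<omega>) (value_2 S \<omega>)"

text \<open>The operators act on real random variables, hence the coercion. It is harmless when
  \<^const>\<open>double_value\<close> is in \<open>L\<^sup>p\<close>, since then \<open>\<psi> \<tau> \<tau> \<le> new_reward \<tau> \<le> double_value \<tau>\<close> a.s.\<close>

definition single_value :: "('a \<Rightarrow> real) \<Rightarrow> 'a \<Rightarrow> ereal"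
  where "single_value S = ess_sup M {\<rho> S \<tau> (\<lambda>\<omega>. real_of_ereal (new_reward \<tau> \<omega>)) | \<tau>.
    \<tau> \<in> bermudan_from M F T \<theta> S}"

end

end

theory Submission
  imports Defs
begin

text \<open>
  Say that a pair \<open>(\<tau>\<^sub>1, \<tau>\<^sub>2)\<close> of Bermudan stopping times is initial for \<open>\<tau>\<close> if
  \<open>\<tau>\<^sub>1 \<sqinter> \<tau>\<^sub>2 = \<tau>\<close> a.s. (pointwise minimum), that is, if the earlier of the two stopping decisions is
  due at \<open>\<tau>\<close>. The proof rests on a description of the new reward: \<open>\<phi>(\<tau>)\<close> is the essential supremum of
  \<open>\<rho>\<^bsub>\<tau>, \<tau>\<^sub>1 \<squnion> \<tau>\<^sub>2\<^esub>[\<psi>(\<tau>\<^sub>1, \<tau>\<^sub>2)]\<close> over the pairs that are initial for \<open>\<tau>\<close>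
  (\<open>new_reward_eq_ess_sup_initial_values\<close>). Indeed the pairs \<open>(\<tau>\<^sub>1, \<tau>)\<close> and \<open>(\<tau>, \<tau>\<^sub>2)\<close>, which define
  \<open>v\<^sub>1\<close> and \<open>v\<^sub>2\<close>, are initial; conversely, for an initial pair the operator started at \<open>\<tau>\<close> sees \<open>\<tau>\<^sub>2\<close>
  replaced by \<open>\<tau>\<close> on \<open>{\<tau>\<^sub>2 = \<tau>}\<close> and \<open>\<tau>\<^sub>1\<close> replaced by \<open>\<tau>\<close> on \<open>{\<tau>\<^sub>1 = \<tau>}\<close>
  (\<open>rho_second_time_now\<close>), and these two events cover the whole space up to a null set.

  The same replacement gives a zero-one law for initial pairs (\<open>zero_one_initial\<close>): on an event
  of \<open>\<F>\<^sub>\<tau>\<close> on which two initial pairs agree, so do their evaluations at \<open>\<tau>\<close>.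
  Pasting two initial pairs along an event of \<open>\<F>\<^sub>\<tau>\<close> therefore shows that the evaluations of initial pairs are upward directed, so that \<open>\<phi>(\<tau>)\<close> is
  the limit of a non-decreasing sequence of them.

  Now both inequalities follow from consistency. For \<open>u \<le> V\<close>, take such a sequence for \<open>\<phi>(\<tau>)\<close>,
  apply \<open>\<rho>\<^bsub>S, \<tau>\<^esub>\<close>, and use the monotone Fatou property: by consistency each term becomes
  \<open>\<rho>\<^bsub>S, \<tau>\<^sub>1 \<squnion> \<tau>\<^sub>2\<^esub>[\<psi>(\<tau>\<^sub>1, \<tau>\<^sub>2)] \<le> V(S)\<close>. For \<open>V \<le> u\<close>, every pair is initial for its own minimum
  \<open>m = \<tau>\<^sub>1 \<sqinter> \<tau>\<^sub>2\<close>, hence \<open>\<rho>\<^bsub>m, \<tau>\<^sub>1 \<squnion> \<tau>\<^sub>2\<^esub>[\<psi>(\<tau>\<^sub>1, \<tau>\<^sub>2)] \<le> \<phi>(m)\<close>, and \<open>\<rho>\<^bsub>S, m\<^esub>\<close> of the left-hand side is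
  \<open>\<rho>\<^bsub>S, \<tau>\<^sub>1 \<squnion> \<tau>\<^sub>2\<^esub>[\<psi>(\<tau>\<^sub>1, \<tau>\<^sub>2)]\<close>.

  Two technical points recur. Stopping times are compared only a.s.; since \<open>\<F>\<^sub>0\<close> contains all null
  sets, the stopped sigma-algebras do not notice this. And the operators act on representatives,
  so an essential supremum, which is chosen measurable for \<open>M\<close> only, has to be shown
  \<open>\<F>\<^sub>\<tau>\<close>-measurable before an operator may be applied to it.\<close>

section \<open>Essential suprema of upward directed families\<close>

lemma (in finite_measure) ess_sup_upper:
  "X \<subseteq> borel_measurable M \<Longrightarrow> x \<in> X \<Longrightarrow> AE \<omega> in M. ereal (x \<omega>) \<le> ess_sup M X \<omega>"
  using is_ess_sup_ess_sup by (auto simp: is_ess_sup_def)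

lemma (in finite_measure) measurable_ess_sup:
  "X \<subseteq> borel_measurable M \<Longrightarrow> ess_sup M X \<in> borel_measurable M"
  using is_ess_sup_ess_sup by (auto simp: is_ess_sup_def)

lemma (in finite_measure) ess_sup_least:
  assumes "X \<subseteq> borel_measurable M" "Z \<in> borel_measurable M"
    and "\<And>x. x \<in> X \<Longrightarrow> AE \<omega> in M. ereal (x \<omega>) \<le> Z \<omega>"
  shows "AE \<omega> in M. ess_sup M X \<omega> \<le> Z \<omega>"
  using is_ess_sup_ess_sup[OF assms(1)] assms(2,3) by (simp add: is_ess_sup_def)

text \<open>For each rational \<open>q\<close> countably many members exhaust, up to a null set, the region where some
  member exceeds \<open>q\<close>. Collecting these over all \<open>q\<close> yields a countable subfamily whose pointwise
  supremum already dominates every member a.s., hence the essential supremum.\<close>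

lemma (in finite_measure) ess_sup_countable_subfamily:
  assumes X: "X \<subseteq> borel_measurable M"
  obtains D where "countable D" "D \<subseteq> X" "AE \<omega> in M. ess_sup M X \<omega> \<le> (SUP x\<in>D. ereal (x \<omega>))"
proof -
  define L where "L q x = {\<omega>\<in>space M. real_of_rat q < x \<omega>}" for q and x :: "'a \<Rightarrow> real"
  have L: "L q x \<in> sets M" if "x \<in> X" for q x
    using that X unfolding L_def by (auto intro!: borel_measurable_less)
  have "\<forall>q. \<exists>C. countable C \<and> C \<subseteq> X \<and> (\<forall>x\<in>X. L q x - (\<Union>c\<in>C. L q c) \<in> null_sets M)"
  proof
    fix q
    obtain C where "countable C" "C \<subseteq> X" "\<And>x. x \<in> X \<Longrightarrow> L q x - (\<Union>c\<in>C. L q c) \<in> null_sets M"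
      using ess_union[of X "L q", OF L] by blast
    then show "\<exists>C. countable C \<and> C \<subseteq> X \<and> (\<forall>x\<in>X. L q x - (\<Union>c\<in>C. L q c) \<in> null_sets M)"
      by (intro exI[of _ C]) simp
  qed
  then obtain C where *: "\<forall>q. countable (C q) \<and> C q \<subseteq> X \<and>
      (\<forall>x\<in>X. L q x - (\<Union>c\<in>C q. L q c) \<in> null_sets M)"
    by (rule exE[OF choice])
  have C: "countable (C q)" "C q \<subseteq> X" "x \<in> X \<Longrightarrow> L q x - (\<Union>c\<in>C q. L q c) \<in> null_sets M" for q x
    using spec[OF *, of q] by simp_all
  define D where "D = (\<Union>q. C q)"
  have D: "countable D" "D \<subseteq> X"
    using C(1,2) by (auto simp: D_def)
  have "AE \<omega> in M. ess_sup M X \<omega> \<le> (SUP x\<in>D. ereal (x \<omega>))"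
  proof (rule ess_sup_least[OF X])
    show "(\<lambda>\<omega>. SUP x\<in>D. ereal (x \<omega>)) \<in> borel_measurable M"
      using D X by (intro borel_measurable_SUP) auto
    fix x assume x: "x \<in> X"
    have "AE \<omega> in M. \<forall>q. \<omega> \<notin> L q x - (\<Union>c\<in>C q. L q c)"
      unfolding AE_all_countable using C(3)[OF x] by (intro allI AE_not_in)
    with AE_space show "AE \<omega> in M. ereal (x \<omega>) \<le> (SUP x\<in>D. ereal (x \<omega>))"
    proof eventually_elim
      case (elim \<omega>)
      show ?case
      proof (rule ccontr)
        assume "\<not> ereal (x \<omega>) \<le> (SUP x\<in>D. ereal (x \<omega>))"
        then obtain q where q: "(SUP x\<in>D. ereal (x \<omega>)) < real_of_rat q" "real_of_rat q < ereal (x \<omega>)"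
          using ereal_dense3[of "SUP x\<in>D. ereal (x \<omega>)" "ereal (x \<omega>)"] by (auto simp only: not_le)
        then obtain c where c: "c \<in> C q" "real_of_rat q < c \<omega>"
          using elim by (auto simp: L_def)
        then have "ereal (c \<omega>) \<le> (SUP x\<in>D. ereal (x \<omega>))"
          by (intro SUP_upper) (auto simp: D_def)
        with q(1) have "c \<omega> < real_of_rat q"
          using le_less_trans[of "ereal (c \<omega>)"] by fastforce
        with c(2) show False
          by simp
      qed
    qed
  qed
  with D show thesis
    by (rule that)
qed

text \<open>Along a countable subfamily that exhausts the essential supremum, directedness allows choosing
  one member after the other above the preceding choice and above the next element of the
  subfamily.\<close>

lemma (in finite_measure) ess_sup_directed:
  assumes X: "X \<subseteq> borel_measurable M" and ne: "X \<noteq> {}"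
    and dir: "\<And>x y. x \<in> X \<Longrightarrow> y \<in> X \<Longrightarrow> \<exists>z\<in>X. AE \<omega> in M. max (x \<omega>) (y \<omega>) \<le> z \<omega>"
  obtains w :: "nat \<Rightarrow> 'a \<Rightarrow> real" where "\<forall>n. w n \<in> X" "AE \<omega> in M. incseq (\<lambda>n. w n \<omega>)"
    "AE \<omega> in M. (SUP n. ereal (w n \<omega>)) = ess_sup M X \<omega>"
proof -
  obtain D where D: "countable D" "D \<subseteq> X" "AE \<omega> in M. ess_sup M X \<omega> \<le> (SUP x\<in>D. ereal (x \<omega>))"
    using ess_sup_countable_subfamily[OF X] .
  obtain x0 where x0: "x0 \<in> X"
    using ne by blast
  \<comment> \<open>adjoining \<open>x0\<close> makes the family nonempty, so that it has an enumeration\<close>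
  define z where "z = from_nat_into (insert x0 D)"
  have range_z: "range z = insert x0 D"
    unfolding z_def using D(1) by (intro range_from_nat_into) auto
  then have z: "z n \<in> X" for n
    using D(2) x0 by (metis insert_subset rangeI subset_iff)
  have "\<exists>w. \<forall>n. (w n \<in> X \<and> (AE \<omega> in M. z n \<omega> \<le> w n \<omega>)) \<and> (AE \<omega> in M. w n \<omega> \<le> w (Suc n) \<omega>)"
  proof (rule dependent_nat_choice)
    show "\<exists>x. x \<in> X \<and> (AE \<omega> in M. z 0 \<omega> \<le> x \<omega>)"
      using z by auto
    fix x n assume "x \<in> X \<and> (AE \<omega> in M. z n \<omega> \<le> x \<omega>)"
    then obtain y where "y \<in> X" "AE \<omega> in M. max (x \<omega>) (z (Suc n) \<omega>) \<le> y \<omega>"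
      using dir[of x "z (Suc n)"] z by auto
    then show "\<exists>y. (y \<in> X \<and> (AE \<omega> in M. z (Suc n) \<omega> \<le> y \<omega>)) \<and> (AE \<omega> in M. x \<omega> \<le> y \<omega>)"
      by auto
  qed
  then obtain w where w: "\<And>n. w n \<in> X" "\<And>n. AE \<omega> in M. z n \<omega> \<le> w n \<omega>"
    "\<And>n. AE \<omega> in M. w n \<omega> \<le> w (Suc n) \<omega>"
    by blast
  have "AE \<omega> in M. \<forall>n. w n \<omega> \<le> w (Suc n) \<omega>"
    using w(3) by (simp add: AE_all_countable)
  then have inc: "AE \<omega> in M. incseq (\<lambda>n. w n \<omega>)"
    by eventually_elim (rule incseq_SucI, simp)
  have "AE \<omega> in M. \<forall>n. z n \<omega> \<le> w n \<omega>" "AE \<omega> in M. \<forall>n. ereal (w n \<omega>) \<le> ess_sup M X \<omega>"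
    using w(1,2) ess_sup_upper[OF X] by (simp_all add: AE_all_countable)
  with D(3) have "AE \<omega> in M. (SUP n. ereal (w n \<omega>)) = ess_sup M X \<omega>"
  proof eventually_elim
    case (elim \<omega>)
    have *: "(SUP x\<in>D. ereal (x \<omega>)) \<le> (SUP n. ereal (w n \<omega>))"
    proof (rule SUP_least)
      fix x assume "x \<in> D"
      then obtain n where "x = z n"
        using range_z by blast
      then have "ereal (x \<omega>) \<le> ereal (w n \<omega>)"
        using elim(2) by simp
      also have "\<dots> \<le> (SUP n. ereal (w n \<omega>))"
        by (rule SUP_upper) simp
      finally show "ereal (x \<omega>) \<le> (SUP n. ereal (w n \<omega>))" .
    qed
    have "(SUP n. ereal (w n \<omega>)) \<le> ess_sup M X \<omega>"
      using elim(3) by (intro SUP_least) simp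
    then show ?case
      using order.trans[OF elim(1) *] by (rule order.antisym)
  qed
  with allI[OF w(1)] inc show thesis
    by (rule that)
qed

section \<open>Domination in \<open>L\<^sup>p\<close>\<close>

lemma Lp_subalgebra:
  assumes "subalgebra M G" "f \<in> Lp M p G"
  shows "f \<in> Lp M p M"
  using assms measurable_from_subalg[OF assms(1)] by (auto simp: Lp_def split: if_splits)

text \<open>The bound is a maximum rather than a sum because this is what a function lying between \<open>g\<close> and
  \<open>h\<close> satisfies.\<close>

lemma Lp_dominated:
  assumes G: "subalgebra M G" and f: "f \<in> borel_measurable G"
    and g: "g \<in> Lp M p M" and h: "h \<in> Lp M p M"
    and le: "AE \<omega> in M. \<bar>f \<omega>\<bar> \<le> max \<bar>g \<omega>\<bar> \<bar>h \<omega>\<bar>"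
  shows "f \<in> Lp M p G"
proof -
  have fM[measurable]: "f \<in> borel_measurable M"
    using measurable_from_subalg[OF G f] .
  have [measurable]: "g \<in> borel_measurable M" "h \<in> borel_measurable M"
    using g h by (auto simp: Lp_def)
  show ?thesis
  proof (cases "p = \<infinity>")
    case True
    let ?c = "max (esssup M (\<lambda>\<omega>. ereal \<bar>g \<omega>\<bar>)) (esssup M (\<lambda>\<omega>. ereal \<bar>h \<omega>\<bar>))"
    have "AE \<omega> in M. ereal \<bar>f \<omega>\<bar> \<le> ?c"
      using le esssup_AE[of "\<lambda>\<omega>. ereal \<bar>g \<omega>\<bar>" M] esssup_AE[of "\<lambda>\<omega>. ereal \<bar>h \<omega>\<bar>" M]
    proof eventually_elim
      case (elim \<omega>)
      have "ereal \<bar>f \<omega>\<bar> \<le> max (ereal \<bar>g \<omega>\<bar>) (ereal \<bar>h \<omega>\<bar>)"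
        using elim(1) by (auto simp: max_def split: if_splits)
      also have "\<dots> \<le> ?c"
        using elim(2,3) by (intro max.mono)
      finally show ?case .
    qed
    then have "esssup M (\<lambda>\<omega>. ereal \<bar>f \<omega>\<bar>) \<le> ?c"
      by (intro esssup_I) auto
    also have "?c < \<infinity>"
      using g h True by (simp add: Lp_def max_def)
    finally show ?thesis
      using f True by (simp add: Lp_def)
  next
    case False
    let ?q = "enn2real p"
    have "integrable M (\<lambda>\<omega>. \<bar>f \<omega>\<bar> powr ?q)"
    proof (rule Bochner_Integration.integrable_bound)
      show "integrable M (\<lambda>\<omega>. \<bar>g \<omega>\<bar> powr ?q + \<bar>h \<omega>\<bar> powr ?q)"
        using g h False by (auto simp: Lp_def)
      show "AE \<omega> in M. norm (\<bar>f \<omega>\<bar> powr ?q) \<le> norm (\<bar>g \<omega>\<bar> powr ?q + \<bar>h \<omega>\<bar> powr ?q)"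
        using le
      proof eventually_elim
        case (elim \<omega>)
        have "\<bar>f \<omega>\<bar> powr ?q \<le> max \<bar>g \<omega>\<bar> \<bar>h \<omega>\<bar> powr ?q"
          using elim by (intro powr_mono2) auto
        also have "\<dots> \<le> \<bar>g \<omega>\<bar> powr ?q + \<bar>h \<omega>\<bar> powr ?q"
          by (auto simp: max_def)
        finally show ?case
          by simp
      qed
    qed simp
    then show ?thesis
      using f False by (simp add: Lp_def)
  qed
qed

section \<open>Stopped sigma-algebras and almost sure comparison\<close>

context bermudan_setting
begin

abbreviation "\<Theta> \<equiv> bermudan M F T \<theta>"
abbreviation "\<Theta>_from \<equiv> bermudan_from M F T \<theta>"

lemma null_sets_F: "N \<in> null_sets M \<Longrightarrow> 0 \<le> t \<Longrightarrow> N \<in> sets (F t)"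
  using F_complete sets_F_mono[of 0 t] by auto

lemma subalgebra_stopped: "\<sigma> \<in> stopping_times M F T \<Longrightarrow> subalgebra M (stopped M F \<sigma>)"
proof (unfold subalgebra_def, intro conjI subsetI)
  fix A assume \<sigma>: "\<sigma> \<in> stopping_times M F T" and A: "A \<in> sets (stopped M F \<sigma>)"
  have "A \<subseteq> space M"
    using sets.sets_into_space[OF A] by (simp add: space_pre_sigma)
  then have "{\<omega>\<in>A. \<sigma> \<omega> \<le> T} = A"
    using \<sigma> by (auto simp: stopping_times_def)
  then show "A \<in> sets M"
    using sets_pre_sigmaD[of \<sigma> A T] A \<sigma> F_sub by (auto simp: stopping_times_def)
qed (simp add: space_pre_sigma)

text \<open>On \<open>A\<close> the event \<open>{\<sigma> \<le> t}\<close> is contained in \<open>{\<tau> \<le> t}\<close> up to a null set, so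
  \<open>X \<inter> A \<inter> {\<sigma> \<le> t}\<close> is the intersection of \<open>X \<inter> {\<tau> \<le> t}\<close> and \<open>A \<inter> {\<sigma> \<le> t}\<close>, both in \<open>F t\<close>, apart
  from a null set, which also lies in \<open>F t\<close>. For negative \<open>t\<close> the event is empty.\<close>

lemma sets_stopped_restrict:
  assumes \<sigma>: "\<sigma> \<in> stopping_times M F T" and \<tau>: "\<tau> \<in> stopping_times M F T"
    and A: "A \<in> sets (stopped M F \<sigma>)" and X: "X \<in> sets (stopped M F \<tau>)"
    and le: "AE \<omega> in M. \<omega> \<in> A \<longrightarrow> \<tau> \<omega> \<le> \<sigma> \<omega>"
  shows "X \<inter> A \<in> sets (stopped M F \<sigma>)"
proof (rule sets_pre_sigmaI)
  show "stopping_time F \<sigma>"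
    using \<sigma> by (simp add: stopping_times_def)
  have \<Omega>: "A \<subseteq> space M" "X \<subseteq> space M"
    using sets.sets_into_space[OF A] sets.sets_into_space[OF X] by (simp_all add: space_pre_sigma)
  fix t
  show "{\<omega>\<in>X \<inter> A. \<sigma> \<omega> \<le> t} \<in> sets (F t)"
  proof (cases "0 \<le> t")
    case False
    then have "{\<omega>\<in>X \<inter> A. \<sigma> \<omega> \<le> t} = {}"
      using \<sigma> \<Omega> by (force simp: stopping_times_def)
    then show ?thesis
      by (simp only: sets.empty_sets)
  next
    case True
    define N where "N = {\<omega>\<in>space M. \<not> (\<omega> \<in> A \<longrightarrow> \<tau> \<omega> \<le> \<sigma> \<omega>)}"
    have "N \<in> null_sets M"
      using le unfolding AE_iff_null_sets N_def .
    then have "{\<omega>\<in>X \<inter> A. \<sigma> \<omega> \<le> t} \<inter> N \<in> sets (F t)"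
      using True by (rule null_sets_F[OF complete2[OF Int_lower2]])
    moreover have "{\<omega>\<in>X. \<tau> \<omega> \<le> t} \<in> sets (F t)" "{\<omega>\<in>A. \<sigma> \<omega> \<le> t} \<in> sets (F t)"
      using \<sigma> \<tau> sets_pre_sigmaD[OF _ X] sets_pre_sigmaD[OF _ A] by (simp_all add: stopping_times_def)
    ultimately have "({\<omega>\<in>X. \<tau> \<omega> \<le> t} \<inter> {\<omega>\<in>A. \<sigma> \<omega> \<le> t}) \<union> ({\<omega>\<in>X \<inter> A. \<sigma> \<omega> \<le> t} \<inter> N) \<in> sets (F t)"
      by (rule sets.Un[OF sets.Int, rotated 2])
    also have "({\<omega>\<in>X. \<tau> \<omega> \<le> t} \<inter> {\<omega>\<in>A. \<sigma> \<omega> \<le> t}) \<union> ({\<omega>\<in>X \<inter> A. \<sigma> \<omega> \<le> t} \<inter> N) =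
        {\<omega>\<in>X \<inter> A. \<sigma> \<omega> \<le> t}"
    proof -
      have "\<tau> \<omega> \<le> t" if "\<omega> \<in> X \<inter> A" "\<sigma> \<omega> \<le> t" "\<omega> \<notin> N" for \<omega>
        using that \<Omega> by (fastforce simp: N_def)
      then show ?thesis
        by blast
    qed
    finally show ?thesis .
  qed
qed

lemma sets_stopped_mono:
  assumes \<sigma>: "\<sigma> \<in> stopping_times M F T" and \<tau>: "\<tau> \<in> stopping_times M F T"
    and le: "AE \<omega> in M. \<tau> \<omega> \<le> \<sigma> \<omega>"
  shows "sets (stopped M F \<tau>) \<subseteq> sets (stopped M F \<sigma>)"
proof
  fix X assume X: "X \<in> sets (stopped M F \<tau>)"
  have "space M \<in> sets (stopped M F \<sigma>)"
    using sets.top[of "stopped M F \<sigma>"] by (simp add: space_pre_sigma)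
  moreover have "X \<inter> space M = X"
    using sets.sets_into_space[OF X] by (auto simp: space_pre_sigma)
  ultimately show "X \<in> sets (stopped M F \<sigma>)"
    using sets_stopped_restrict[OF \<sigma> \<tau> _ X, of "space M"] le by auto
qed

lemma null_sets_stopped:
  assumes \<sigma>: "\<sigma> \<in> stopping_times M F T" and N: "N \<in> null_sets M"
  shows "N \<in> sets (stopped M F \<sigma>)"
proof (rule sets_pre_sigmaI)
  show "stopping_time F \<sigma>"
    using \<sigma> by (simp add: stopping_times_def)
  have "N \<subseteq> space M"
    using N by (meson null_setsD2 sets.sets_into_space)
  then have empty: "{\<omega>\<in>N. \<sigma> \<omega> \<le> t} = {}" if "t < 0" for t
    using \<sigma> that by (force simp: stopping_times_def)
  show "{\<omega>\<in>N. \<sigma> \<omega> \<le> t} \<in> sets (F t)" for t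
  proof (cases "0 \<le> t")
    case True
    have "{\<omega>\<in>N. \<sigma> \<omega> \<le> t} \<in> null_sets M"
      using N by (rule complete2[rotated]) auto
    then show ?thesis
      using True by (rule null_sets_F)
  next
    case False
    then show ?thesis
      using empty[of t] by (simp only: not_le sets.empty_sets)
  qed
qed

lemma measurable_stopped_AE_cong:
  assumes \<sigma>: "\<sigma> \<in> stopping_times M F T" and g: "g \<in> borel_measurable (stopped M F \<sigma>)"
    and eq: "AE \<omega> in M. f \<omega> = g \<omega>"
  shows "f \<in> borel_measurable (stopped M F \<sigma>)"
proof (rule measurableI)
  fix B :: "'b set" assume B: "B \<in> sets borel"
  \<comment> \<open>changing \<open>g\<close> on the null set \<open>N\<close> alters preimages only within \<open>N\<close>, and
    every stopped sigma-algebra contains the subsets of null sets\<close>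
  define N where "N = {\<omega>\<in>space M. f \<omega> \<noteq> g \<omega>}"
  have N: "N \<in> null_sets M"
    using eq unfolding AE_iff_null_sets N_def .
  have "f -` B \<inter> N \<in> sets (stopped M F \<sigma>)"
    by (rule null_sets_stopped[OF \<sigma> complete2[OF Int_lower2 N]])
  moreover have "N \<in> sets (stopped M F \<sigma>)"
    using \<sigma> N by (rule null_sets_stopped)
  moreover have "g -` B \<inter> space M \<in> sets (stopped M F \<sigma>)"
    using measurable_sets[OF g B] by (simp add: space_pre_sigma)
  ultimately have "(g -` B \<inter> space M - N) \<union> (f -` B \<inter> N) \<in> sets (stopped M F \<sigma>)"
    by blast
  moreover have "(g -` B \<inter> space M - N) \<union> (f -` B \<inter> N) = f -` B \<inter> space (stopped M F \<sigma>)"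
    by (auto simp: N_def space_pre_sigma)
  ultimately show "f -` B \<inter> space (stopped M F \<sigma>) \<in> sets (stopped M F \<sigma>)"
    by simp
qed simp

lemma measurable_stopped_If:
  assumes \<sigma>: "\<sigma> \<in> stopping_times M F T" and \<tau>: "\<tau> \<in> stopping_times M F T"
    and f: "f \<in> borel_measurable (stopped M F \<tau>)" and g: "g \<in> borel_measurable (stopped M F \<sigma>)"
    and A: "A \<in> sets (stopped M F \<sigma>)" and le: "AE \<omega> in M. \<omega> \<in> A \<longrightarrow> \<tau> \<omega> \<le> \<sigma> \<omega>"
  shows "(\<lambda>\<omega>. if \<omega> \<in> A then f \<omega> else g \<omega>) \<in> borel_measurable (stopped M F \<sigma>)"
proof (rule measurableI)
  fix B :: "'b set" assume B: "B \<in> sets borel"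
  let ?h = "\<lambda>\<omega>. if \<omega> \<in> A then f \<omega> else g \<omega>"
  have "(f -` B \<inter> space M) \<inter> A \<in> sets (stopped M F \<sigma>)"
    using measurable_sets[OF f B] by (intro sets_stopped_restrict[OF \<sigma> \<tau> A _ le]) (simp add: space_pre_sigma)
  moreover have "(g -` B \<inter> space M) - A \<in> sets (stopped M F \<sigma>)"
    using measurable_sets[OF g B] A by (simp add: space_pre_sigma)
  moreover have "?h -` B \<inter> space (stopped M F \<sigma>) =
      ((f -` B \<inter> space M) \<inter> A) \<union> ((g -` B \<inter> space M) - A)"
    by (auto simp: space_pre_sigma split: if_splits)
  ultimately show "?h -` B \<inter> space (stopped M F \<sigma>) \<in> sets (stopped M F \<sigma>)"
    by (simp add: sets.Un)
qed simp

lemma sets_stopped_le: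
  assumes \<sigma>: "\<sigma> \<in> stopping_times M F T" and \<tau>: "\<tau> \<in> stopping_times M F T"
  shows "{\<omega>\<in>space M. \<tau> \<omega> \<le> \<sigma> \<omega>} \<in> sets (stopped M F \<sigma>)"
proof -
  have "{\<omega>\<in>space M. \<sigma> \<omega> < \<tau> \<omega>} \<in> sets (stopped M F \<sigma>)"
    using stopping_time_less[of \<sigma> \<tau>] \<sigma> \<tau> by (auto simp: stopping_times_def pred_def space_pre_sigma)
  then have "space (stopped M F \<sigma>) - {\<omega>\<in>space M. \<sigma> \<omega> < \<tau> \<omega>} \<in> sets (stopped M F \<sigma>)"
    by (rule sets.compl_sets)
  moreover have "space (stopped M F \<sigma>) - {\<omega>\<in>space M. \<sigma> \<omega> < \<tau> \<omega>} = {\<omega>\<in>space M. \<tau> \<omega> \<le> \<sigma> \<omega>}"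
    by (auto simp: space_pre_sigma)
  ultimately show ?thesis
    by simp
qed

lemma sets_stopped_eq:
  assumes \<sigma>: "\<sigma> \<in> stopping_times M F T" and \<tau>: "\<tau> \<in> stopping_times M F T"
  shows "{\<omega>\<in>space M. \<tau> \<omega> = \<sigma> \<omega>} \<in> sets (stopped M F \<sigma>)"
proof -
  have "{\<omega>\<in>space M. \<sigma> \<omega> \<le> \<tau> \<omega>} \<inter> {\<omega>\<in>space M. \<tau> \<omega> \<le> \<sigma> \<omega>} \<in> sets (stopped M F \<sigma>)"
    by (intro sets_stopped_restrict[OF \<sigma> \<tau>] sets_stopped_le \<sigma> \<tau>) auto
  moreover have "{\<omega>\<in>space M. \<sigma> \<omega> \<le> \<tau> \<omega>} \<inter> {\<omega>\<in>space M. \<tau> \<omega> \<le> \<sigma> \<omega>} = {\<omega>\<in>space M. \<tau> \<omega> = \<sigma> \<omega>}"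
    by auto
  ultimately show ?thesis
    by simp
qed

section \<open>Lattice and pasting properties of Bermudan stopping times\<close>

text \<open>The partition in the definition can be recovered from \<open>\<tau>\<close>: let \<open>A\<^sub>k\<close> be the event that \<open>k\<close> is
  the first index with \<open>\<tau> = \<theta>\<^sub>k\<close>. It lies in the sigma-algebra stopped at \<open>\<theta>\<^sub>k\<close> because the events
  \<open>{\<tau> = \<theta>\<^sub>j}\<close> with \<open>j \<le> k\<close> do. In this form, closure under maximum, minimum and pasting only asks
  for the values of the new stopping time.\<close>

lemma bermudan_iff:
  "\<tau> \<in> \<Theta> \<longleftrightarrow> \<tau> \<in> stopping_times M F T \<and> (AE \<omega> in M. \<tau> \<omega> = T \<or> (\<exists>k. \<tau> \<omega> = \<theta> k \<omega>))"
proof safe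
  assume "\<tau> \<in> \<Theta>"
  then obtain A B where \<tau>: "\<tau> \<in> stopping_times M F T" and AB: "disjoint_family A"
    "(\<Union>k. A k) \<inter> B = {}" "(\<Union>k. A k) \<union> B = space M"
    and eq: "AE \<omega> in M. \<tau> \<omega> = (\<Sum>k. \<theta> k \<omega> * indicat_real (A k) \<omega>) + T * indicat_real B \<omega>"
    by (auto simp: bermudan_def)
  show "\<tau> \<in> stopping_times M F T"
    by fact
  show "AE \<omega> in M. \<tau> \<omega> = T \<or> (\<exists>k. \<tau> \<omega> = \<theta> k \<omega>)"
    using eq AE_space
  proof eventually_elim
    case (elim \<omega>)
    show ?case
    proof (cases "\<omega> \<in> B")
      case True
      then have "\<omega> \<notin> A k" for k
        using AB(2) by auto
      with True elim show ?thesis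
        by simp
    next
      case False
      then obtain k where k: "\<omega> \<in> A k"
        using elim(2) AB(3) by auto
      then have "indicat_real (A j) \<omega> = (if j = k then 1 else 0)" for j
        using disjoint_family_onD[OF AB(1), of j k] by (auto simp: indicator_def)
      then have "(\<lambda>j. \<theta> j \<omega> * indicat_real (A j) \<omega>) = (\<lambda>j. if j = k then \<theta> j \<omega> else 0)"
        by auto
      then have "(\<Sum>j. \<theta> j \<omega> * indicat_real (A j) \<omega>) = \<theta> k \<omega>"
        using sums_single[of k "\<lambda>j. \<theta> j \<omega>"] by (simp add: sums_iff)
      with elim False show ?thesis
        by auto
    qed
  qed
next
  assume \<tau>: "\<tau> \<in> stopping_times M F T" and ex: "AE \<omega> in M. \<tau> \<omega> = T \<or> (\<exists>k. \<tau> \<omega> = \<theta> k \<omega>)"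
  define E where "E k = {\<omega>\<in>space M. \<tau> \<omega> = \<theta> k \<omega>}" for k
  have mono: "AE \<omega> in M. \<theta> j \<omega> \<le> \<theta> k \<omega>" if "j \<le> k" for j k
  proof -
    have "AE \<omega> in M. \<forall>k. \<theta> k \<omega> \<le> \<theta> (Suc k) \<omega>"
      using theta_mono by (simp add: AE_all_countable)
    then show ?thesis
    proof eventually_elim
      case (elim \<omega>)
      then show ?case
        using lift_Suc_mono_le[of "\<lambda>k. \<theta> k \<omega>", OF _ that] by blast
    qed
  qed
  have E: "E j \<in> sets (stopped M F (\<theta> k))" if "j \<le> k" for j k
    using sets_stopped_eq[OF theta_stopping \<tau>, of j]
      sets_stopped_mono[OF theta_stopping theta_stopping mono[OF that]] by (auto simp: E_def)
  have A: "disjointed E k \<in> sets (stopped M F (\<theta> k))" for k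
    unfolding disjointed_def using E by (intro sets.Diff sets.finite_UN) auto
  have E_T: "E k \<in> sets (F T)" for k
  proof -
    have "{\<omega>\<in>E k. \<theta> k \<omega> \<le> T} \<in> sets (F T)"
      using theta_stopping[of k] E[of k k] by (intro sets_pre_sigmaD) (auto simp: stopping_times_def)
    also have "{\<omega>\<in>E k. \<theta> k \<omega> \<le> T} = E k"
      using theta_stopping[of k] by (auto simp: stopping_times_def E_def)
    finally show ?thesis .
  qed
  define B where "B = space M - (\<Union>k. E k)"
  have B: "B \<in> sets (F T)"
    unfolding B_def using E_T sets.top[of "F T"] by (auto simp: space_F)
  have "(\<Union>k. E k) \<subseteq> space M"
    by (auto simp: E_def)
  then have part: "(\<Union>k. disjointed E k) \<inter> B = {}" "(\<Union>k. disjointed E k) \<union> B = space M"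
    unfolding UN_disjointed_eq by (auto simp: B_def)
  have "AE \<omega> in M. \<tau> \<omega> = (\<Sum>k. \<theta> k \<omega> * indicat_real (disjointed E k) \<omega>) + T * indicat_real B \<omega>"
    using ex AE_space
  proof eventually_elim
    case (elim \<omega>)
    show ?case
    proof (cases "\<omega> \<in> B")
      case True
      then have "\<omega> \<notin> disjointed E k" for k
        using part(1) by auto
      moreover have "\<tau> \<omega> = T"
        using True elim by (auto simp: B_def E_def)
      ultimately show ?thesis
        using True by simp
    next
      case False
      then obtain k where k: "\<omega> \<in> disjointed E k"
        using elim(2) part(2) by auto
      then have "indicat_real (disjointed E j) \<omega> = (if j = k then 1 else 0)" for j
        using disjoint_family_onD[OF disjoint_family_disjointed[of E], of j k]
        by (auto simp: indicator_def)
      then have "(\<lambda>j. \<theta> j \<omega> * indicat_real (disjointed E j) \<omega>) = (\<lambda>j. if j = k then \<theta> j \<omega> else 0)"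
        by auto
      then have "(\<Sum>j. \<theta> j \<omega> * indicat_real (disjointed E j) \<omega>) = \<theta> k \<omega>"
        using sums_single[of k "\<lambda>j. \<theta> j \<omega>"] by (simp add: sums_iff)
      moreover have "\<tau> \<omega> = \<theta> k \<omega>"
        using k by (auto simp: disjointed_def E_def)
      ultimately show ?thesis
        using False by simp
    qed
  qed
  with \<tau> A B part show "\<tau> \<in> \<Theta>"
    unfolding bermudan_def mem_Collect_eq
    by (intro conjI exI[of _ "disjointed E"] exI[of _ B] allI disjoint_family_disjointed)
qed

lemma bermudan_stopping_times: "\<tau> \<in> \<Theta> \<Longrightarrow> \<tau> \<in> stopping_times M F T"
  by (simp add: bermudan_iff)

lemma bermudan_from_bermudan: "\<tau> \<in> \<Theta>_from S \<Longrightarrow> \<tau> \<in> \<Theta>"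
  by (simp add: bermudan_from_def)

lemma bermudan_max:
  assumes "\<sigma> \<in> \<Theta>" "\<tau> \<in> \<Theta>"
  shows "\<sigma> \<squnion>\<^sub>t \<tau> \<in> \<Theta>"
proof -
  have "AE \<omega> in M. max (\<sigma> \<omega>) (\<tau> \<omega>) = T \<or> (\<exists>k. max (\<sigma> \<omega>) (\<tau> \<omega>) = \<theta> k \<omega>)"
    using assms[unfolded bermudan_iff, THEN conjunct2] by eventually_elim (auto simp: max_def)
  with assms show ?thesis
    by (simp add: bermudan_iff stopping_times_def stopping_time_max le_max_iff_disj)
qed

lemma bermudan_min:
  assumes "\<sigma> \<in> \<Theta>" "\<tau> \<in> \<Theta>"
  shows "\<sigma> \<sqinter>\<^sub>t \<tau> \<in> \<Theta>"
proof -
  have "AE \<omega> in M. min (\<sigma> \<omega>) (\<tau> \<omega>) = T \<or> (\<exists>k. min (\<sigma> \<omega>) (\<tau> \<omega>) = \<theta> k \<omega>)"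
    using assms[unfolded bermudan_iff, THEN conjunct2] by eventually_elim (auto simp: min_def)
  with assms show ?thesis
    by (simp add: bermudan_iff stopping_times_def stopping_time_min min_le_iff_disj)
qed

lemma bermudan_If:
  assumes S: "S \<in> \<Theta>" and A: "A \<in> sets (stopped M F S)"
    and \<sigma>: "\<sigma> \<in> \<Theta>_from S" and \<tau>: "\<tau> \<in> \<Theta>_from S"
  shows "(\<lambda>\<omega>. if \<omega> \<in> A then \<sigma> \<omega> else \<tau> \<omega>) \<in> \<Theta>_from S"
proof -
  let ?\<nu> = "\<lambda>\<omega>. if \<omega> \<in> A then \<sigma> \<omega> else \<tau> \<omega>"
  have st: "S \<in> stopping_times M F T" "\<sigma> \<in> stopping_times M F T" "\<tau> \<in> stopping_times M F T"
    using S \<sigma> \<tau> by (auto simp: bermudan_from_def bermudan_iff)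
  have A\<sigma>: "A \<in> sets (stopped M F \<sigma>)"
    using A \<sigma> sets_stopped_mono[OF st(2,1)] by (auto simp: bermudan_from_def)
  have A\<tau>: "space (stopped M F \<tau>) - A \<in> sets (stopped M F \<tau>)"
    using A \<tau> sets_stopped_mono[OF st(3,1)] by (intro sets.compl_sets) (auto simp: bermudan_from_def)
  have "stopping_time F ?\<nu>"
  proof
    fix t
    have "{\<omega>\<in>A. \<sigma> \<omega> \<le> t} \<union> {\<omega>\<in>space (stopped M F \<tau>) - A. \<tau> \<omega> \<le> t} \<in> sets (F t)"
      using st A\<sigma> A\<tau> by (intro sets.Un sets_pre_sigmaD) (auto simp: stopping_times_def)
    also have "{\<omega>\<in>A. \<sigma> \<omega> \<le> t} \<union> {\<omega>\<in>space (stopped M F \<tau>) - A. \<tau> \<omega> \<le> t} = {\<omega>\<in>space (F t). ?\<nu> \<omega> \<le> t}"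
      using sets.sets_into_space[OF A] by (auto simp: space_F space_pre_sigma)
    finally show "Measurable.pred (F t) (\<lambda>\<omega>. ?\<nu> \<omega> \<le> t)"
      by (simp add: pred_def)
  qed
  with st have "?\<nu> \<in> stopping_times M F T"
    by (auto simp: stopping_times_def)
  moreover
  have "AE \<omega> in M. \<sigma> \<omega> = T \<or> (\<exists>k. \<sigma> \<omega> = \<theta> k \<omega>)" "AE \<omega> in M. S \<omega> \<le> \<sigma> \<omega>"
    "AE \<omega> in M. \<tau> \<omega> = T \<or> (\<exists>k. \<tau> \<omega> = \<theta> k \<omega>)" "AE \<omega> in M. S \<omega> \<le> \<tau> \<omega>"
    using \<sigma> \<tau> by (simp_all add: bermudan_from_def bermudan_iff)
  then have "AE \<omega> in M. (?\<nu> \<omega> = T \<or> (\<exists>k. ?\<nu> \<omega> = \<theta> k \<omega>)) \<and> S \<omega> \<le> ?\<nu> \<omega>"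
    by eventually_elim simp
  ultimately show ?thesis
    by (simp add: bermudan_from_def bermudan_iff)
qed

lemma max_bermudan_from:
  "\<tau> \<in> \<Theta> \<Longrightarrow> \<sigma> \<in> \<Theta> \<Longrightarrow> \<sigma> \<squnion>\<^sub>t \<tau> \<in> \<Theta>_from \<tau>"
  by (simp add: bermudan_from_def bermudan_max)

lemma Lp_stopped_measurable:
  assumes "S \<in> \<Theta>" "f \<in> Lp M p (stopped M F S)"
  shows "f \<in> borel_measurable M"
proof (rule measurable_from_subalg)
  show "subalgebra M (stopped M F S)"
    using assms(1) by (intro subalgebra_stopped bermudan_stopping_times)
  show "f \<in> borel_measurable (stopped M F S)"
    using assms(2) unfolding Lp_def by blast
qed

end

section \<open>Zero-one laws for the reward family\<close>

lemma (in bermudan_evaluation) rho_cong: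
  assumes "S \<in> \<Theta>" "\<tau> \<in> \<Theta>" "\<eta>\<^sub>1 \<in> Lp M p (stopped M F \<tau>)" "\<eta>\<^sub>2 \<in> Lp M p (stopped M F \<tau>)"
    and "AE \<omega> in M. \<eta>\<^sub>1 \<omega> = \<eta>\<^sub>2 \<omega>"
  shows "AE \<omega> in M. \<rho> S \<tau> \<eta>\<^sub>1 \<omega> = \<rho> S \<tau> \<eta>\<^sub>2 \<omega>"
proof -
  have "AE \<omega> in M. \<eta>\<^sub>1 \<omega> \<le> \<eta>\<^sub>2 \<omega>" "AE \<omega> in M. \<eta>\<^sub>2 \<omega> \<le> \<eta>\<^sub>1 \<omega>"
    using assms(5) by auto
  from monotonicity[OF assms(1-4) this(1)] monotonicity[OF assms(1,2,4,3) this(2)]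
  show ?thesis
    by eventually_elim (rule order.antisym)
qed

text \<open>A locale makes the symmetry of the problem usable: it is stable under exchanging the two slots
  of \<open>\<psi>\<close> (\<open>double_stopping_swap\<close>), so each statement about one slot has a twin obtained by
  instantiation.\<close>

locale double_stopping = bermudan_evaluation M F T \<theta> p \<rho>
  for M :: "'a measure" and F T \<theta> p \<rho> +
  fixes \<psi> :: "('a \<Rightarrow> real) \<Rightarrow> ('a \<Rightarrow> real) \<Rightarrow> 'a \<Rightarrow> real"
  assumes bi_admissible: "bi_admissible M F T \<theta> \<psi>"
    and bi_p_integrable: "bi_p_integrable M F T \<theta> p \<psi>"
begin

lemma double_stopping_swap: "double_stopping M F T \<theta> p \<rho> (\<lambda>\<tau>\<^sub>1 \<tau>\<^sub>2. \<psi> \<tau>\<^sub>2 \<tau>\<^sub>1)"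
proof
  show "bi_admissible M F T \<theta> (\<lambda>\<tau>\<^sub>1 \<tau>\<^sub>2. \<psi> \<tau>\<^sub>2 \<tau>\<^sub>1)"
    unfolding bi_admissible_def
  proof (intro conjI ballI)
    fix \<tau>\<^sub>1 \<tau>\<^sub>2 assume t: "\<tau>\<^sub>1 \<in> \<Theta>" "\<tau>\<^sub>2 \<in> \<Theta>"
    then have "\<psi> \<tau>\<^sub>2 \<tau>\<^sub>1 \<in> borel_measurable (stopped M F (\<tau>\<^sub>2 \<squnion>\<^sub>t \<tau>\<^sub>1))"
      using bi_admissible by (simp add: bi_admissible_def)
    then show "\<psi> \<tau>\<^sub>2 \<tau>\<^sub>1 \<in> borel_measurable (stopped M F (\<tau>\<^sub>1 \<squnion>\<^sub>t \<tau>\<^sub>2))"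
      by (simp add: max.commute)
    fix \<sigma>\<^sub>1 \<sigma>\<^sub>2 assume s: "\<sigma>\<^sub>1 \<in> \<Theta>" "\<sigma>\<^sub>2 \<in> \<Theta>"
    have "AE \<omega> in M. \<tau>\<^sub>2 \<omega> = \<sigma>\<^sub>2 \<omega> \<and> \<tau>\<^sub>1 \<omega> = \<sigma>\<^sub>1 \<omega> \<longrightarrow> \<psi> \<tau>\<^sub>2 \<tau>\<^sub>1 \<omega> = \<psi> \<sigma>\<^sub>2 \<sigma>\<^sub>1 \<omega>"
      using bi_admissible t s by (simp add: bi_admissible_def)
    then show "AE \<omega> in M. \<tau>\<^sub>1 \<omega> = \<sigma>\<^sub>1 \<omega> \<and> \<tau>\<^sub>2 \<omega> = \<sigma>\<^sub>2 \<omega> \<longrightarrow> \<psi> \<tau>\<^sub>2 \<tau>\<^sub>1 \<omega> = \<psi> \<sigma>\<^sub>2 \<sigma>\<^sub>1 \<omega>"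
      by eventually_elim simp
  qed
  show "bi_p_integrable M F T \<theta> p (\<lambda>\<tau>\<^sub>1 \<tau>\<^sub>2. \<psi> \<tau>\<^sub>2 \<tau>\<^sub>1)"
    using bi_p_integrable by (simp add: bi_p_integrable_def)
qed

lemma reward_eq:
  assumes "\<tau>\<^sub>1 \<in> \<Theta>" "\<tau>\<^sub>2 \<in> \<Theta>" "\<sigma>\<^sub>1 \<in> \<Theta>" "\<sigma>\<^sub>2 \<in> \<Theta>"
  shows "AE \<omega> in M. \<tau>\<^sub>1 \<omega> = \<sigma>\<^sub>1 \<omega> \<and> \<tau>\<^sub>2 \<omega> = \<sigma>\<^sub>2 \<omega> \<longrightarrow> \<psi> \<tau>\<^sub>1 \<tau>\<^sub>2 \<omega> = \<psi> \<sigma>\<^sub>1 \<sigma>\<^sub>2 \<omega>"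
  using assms bi_admissible by (simp add: bi_admissible_def)

lemma reward_Lp_stopped:
  assumes "\<tau>\<^sub>1 \<in> \<Theta>" "\<tau>\<^sub>2 \<in> \<Theta>" "\<nu> \<in> \<Theta>" and le: "AE \<omega> in M. max (\<tau>\<^sub>1 \<omega>) (\<tau>\<^sub>2 \<omega>) \<le> \<nu> \<omega>"
  shows "\<psi> \<tau>\<^sub>1 \<tau>\<^sub>2 \<in> Lp M p (stopped M F \<nu>)"
proof -
  have st: "\<tau>\<^sub>1 \<squnion>\<^sub>t \<tau>\<^sub>2 \<in> stopping_times M F T" "\<nu> \<in> stopping_times M F T"
    using assms bermudan_max bermudan_stopping_times by auto
  have "subalgebra (stopped M F \<nu>) (stopped M F (\<tau>\<^sub>1 \<squnion>\<^sub>t \<tau>\<^sub>2))"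
    using sets_stopped_mono[OF st(2,1) le] by (simp add: subalgebra_def space_pre_sigma)
  moreover have "\<psi> \<tau>\<^sub>1 \<tau>\<^sub>2 \<in> borel_measurable (stopped M F (\<tau>\<^sub>1 \<squnion>\<^sub>t \<tau>\<^sub>2))"
    using assms bi_admissible by (simp add: bi_admissible_def)
  ultimately have "\<psi> \<tau>\<^sub>1 \<tau>\<^sub>2 \<in> borel_measurable (stopped M F \<nu>)"
    by (rule measurable_from_subalg)
  moreover have "\<psi> \<tau>\<^sub>1 \<tau>\<^sub>2 \<in> Lp M p M"
    using assms bi_p_integrable by (simp add: bi_p_integrable_def)
  ultimately show ?thesis
    unfolding Lp_def by blast
qed

lemma rho_reward_Lp:
  "S \<in> \<Theta> \<Longrightarrow> \<tau>\<^sub>1 \<in> \<Theta> \<Longrightarrow> \<tau>\<^sub>2 \<in> \<Theta> \<Longrightarrow> \<rho> S (\<tau>\<^sub>1 \<squnion>\<^sub>t \<tau>\<^sub>2) (\<psi> \<tau>\<^sub>1 \<tau>\<^sub>2) \<in> Lp M p (stopped M F S)"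
  by (intro rho_Lp reward_Lp_stopped bermudan_max) auto

lemma rho_reward_measurable:
  "S \<in> \<Theta> \<Longrightarrow> \<tau>\<^sub>1 \<in> \<Theta> \<Longrightarrow> \<tau>\<^sub>2 \<in> \<Theta> \<Longrightarrow> \<rho> S (\<tau>\<^sub>1 \<squnion>\<^sub>t \<tau>\<^sub>2) (\<psi> \<tau>\<^sub>1 \<tau>\<^sub>2) \<in> borel_measurable M"
  by (rule Lp_stopped_measurable[OF _ rho_reward_Lp])

text \<open>With the second slot held at \<open>\<tau>\<close>, the reward becomes a family in one stopping time, to which the
  zero-one law applies. It is not admissible as it stands, because \<open>\<psi>(\<kappa>, \<tau>)\<close> is measurable only
  for the sigma-algebra stopped at \<open>\<kappa> \<squnion> \<tau>\<close>; multiplication by the indicator of \<open>{\<tau> \<le> \<kappa>}\<close> repairs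
  this and changes nothing for \<open>\<kappa> \<ge> \<tau>\<close>. The versions \<open>\<nu>\<close>, \<open>\<nu>'\<close> of \<open>\<sigma>\<close>, \<open>\<sigma>'\<close> are there to exchange
  \<open>\<sigma>\<close> for \<open>\<sigma> \<squnion> \<tau>\<close>, an a.s. equal but different function, in the index of the operator.\<close>

lemma zero_one_first_slot:
  assumes \<tau>: "\<tau> \<in> \<Theta>" and A: "A \<in> sets (stopped M F \<tau>)"
    and \<sigma>: "\<sigma> \<in> \<Theta>_from \<tau>" and \<sigma>': "\<sigma>' \<in> \<Theta>_from \<tau>"
    and \<nu>: "\<nu> \<in> \<Theta>_from \<tau>" "AE \<omega> in M. \<nu> \<omega> = \<sigma> \<omega>"
    and \<nu>': "\<nu>' \<in> \<Theta>_from \<tau>" "AE \<omega> in M. \<nu>' \<omega> = \<sigma>' \<omega>"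
    and eq: "AE \<omega> in M. \<omega> \<in> A \<longrightarrow> \<sigma> \<omega> = \<sigma>' \<omega>"
  shows "AE \<omega> in M. \<omega> \<in> A \<longrightarrow> \<rho> \<tau> \<nu> (\<psi> \<sigma> \<tau>) \<omega> = \<rho> \<tau> \<nu>' (\<psi> \<sigma>' \<tau>) \<omega>"
proof -
  define \<xi> where "\<xi> \<nu> = (\<lambda>\<omega>. if \<omega> \<in> {\<omega>\<in>space M. \<tau> \<omega> \<le> \<nu> \<omega>} then \<psi> \<nu> \<tau> \<omega> else 0)" for \<nu>
  have meas: "\<xi> \<kappa> \<in> borel_measurable (stopped M F \<kappa>)" if \<kappa>: "\<kappa> \<in> \<Theta>" for \<kappa>
    unfolding \<xi>_def
  proof (rule measurable_stopped_If)
    show "\<kappa> \<in> stopping_times M F T" "\<kappa> \<squnion>\<^sub>t \<tau> \<in> stopping_times M F T"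
      using \<kappa> \<tau> bermudan_max bermudan_stopping_times by auto
    show "\<psi> \<kappa> \<tau> \<in> borel_measurable (stopped M F (\<kappa> \<squnion>\<^sub>t \<tau>))"
      using \<kappa> \<tau> bi_admissible by (simp add: bi_admissible_def)
    show "{\<omega>\<in>space M. \<tau> \<omega> \<le> \<kappa> \<omega>} \<in> sets (stopped M F \<kappa>)"
      using \<kappa> \<tau> by (intro sets_stopped_le bermudan_stopping_times)
  qed auto
  have Lp: "\<xi> \<kappa> \<in> Lp M p (stopped M F \<kappa>)" if \<kappa>: "\<kappa> \<in> \<Theta>" for \<kappa>
  proof (rule Lp_dominated[OF _ meas[OF \<kappa>]])
    show "subalgebra M (stopped M F \<kappa>)"
      using \<kappa> by (intro subalgebra_stopped bermudan_stopping_times)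
    show "\<psi> \<kappa> \<tau> \<in> Lp M p M" "\<psi> \<kappa> \<tau> \<in> Lp M p M"
      using \<kappa> \<tau> bi_p_integrable by (auto simp: bi_p_integrable_def)
  qed (auto simp: \<xi>_def)
  have "admissible M F T \<theta> \<xi>"
    unfolding admissible_def
  proof (intro conjI ballI meas)
    fix \<kappa> \<kappa>' assume "\<kappa> \<in> \<Theta>" "\<kappa>' \<in> \<Theta>"
    from reward_eq[OF this(1) \<tau> this(2) \<tau>]
    show "AE \<omega> in M. \<kappa> \<omega> = \<kappa>' \<omega> \<longrightarrow> \<xi> \<kappa> \<omega> = \<xi> \<kappa>' \<omega>"
      by eventually_elim (auto simp: \<xi>_def)
  qed
  moreover have "p_integrable M F T \<theta> p \<xi>"
    using Lp Lp_subalgebra[OF subalgebra_stopped[OF bermudan_stopping_times]]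
    unfolding p_integrable_def by blast
  moreover have "AE \<omega> in M. \<omega> \<in> A \<longrightarrow> \<nu> \<omega> = \<nu>' \<omega>"
    using eq \<nu>(2) \<nu>'(2) by eventually_elim simp
  ultimately have *: "AE \<omega> in M. \<omega> \<in> A \<longrightarrow> \<rho> \<tau> \<nu> (\<xi> \<nu>) \<omega> = \<rho> \<tau> \<nu>' (\<xi> \<nu>') \<omega>"
    using \<tau> A \<nu>(1) \<nu>'(1) by (intro zero_one)
  have rho: "AE \<omega> in M. \<rho> \<tau> \<kappa> (\<xi> \<kappa>) \<omega> = \<rho> \<tau> \<kappa> (\<psi> \<mu> \<tau>) \<omega>"
    if \<kappa>: "\<kappa> \<in> \<Theta>_from \<tau>" and \<mu>: "\<mu> \<in> \<Theta>_from \<tau>" and "AE \<omega> in M. \<kappa> \<omega> = \<mu> \<omega>" for \<kappa> \<mu>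
  proof (rule rho_cong[OF \<tau> _ Lp])
    show \<Theta>: "\<kappa> \<in> \<Theta>" "\<kappa> \<in> \<Theta>"
      using \<kappa> by (simp_all add: bermudan_from_def)
    have le: "AE \<omega> in M. \<tau> \<omega> \<le> \<mu> \<omega>" "\<mu> \<in> \<Theta>"
      using \<mu> by (simp_all add: bermudan_from_def)
    have "AE \<omega> in M. max (\<mu> \<omega>) (\<tau> \<omega>) \<le> \<kappa> \<omega>"
      using le(1) that(3) by eventually_elim simp
    then show "\<psi> \<mu> \<tau> \<in> Lp M p (stopped M F \<kappa>)"
      using \<Theta>(1) le(2) \<tau> by (intro reward_Lp_stopped)
    show "AE \<omega> in M. \<xi> \<kappa> \<omega> = \<psi> \<mu> \<tau> \<omega>"
      using reward_eq[OF \<Theta>(1) \<tau> le(2) \<tau>] le(1) that(3) AE_space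
      by eventually_elim (simp add: \<xi>_def)
  qed
  show ?thesis
    using * rho[OF \<nu>(1) \<sigma> \<nu>(2)] rho[OF \<nu>'(1) \<sigma>' \<nu>'(2)] by eventually_elim simp
qed

text \<open>Admissibility in the first index replaces the starting time \<open>\<tau>\<close> by \<open>\<tau>\<^sub>2\<close> on \<open>{\<tau>\<^sub>2 = \<tau>}\<close>; the second
  zero-one law for bi-admissible families then exchanges \<open>\<tau>\<^sub>2\<close> for \<open>\<tau>\<close> everywhere at once.\<close>

lemma rho_second_time_now:
  assumes "\<tau> \<in> \<Theta>" "\<tau>\<^sub>1 \<in> \<Theta>" "\<tau>\<^sub>2 \<in> \<Theta>"
  shows "AE \<omega> in M. \<tau>\<^sub>2 \<omega> = \<tau> \<omega> \<longrightarrow>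
    \<rho> \<tau> (\<tau>\<^sub>1 \<squnion>\<^sub>t \<tau>\<^sub>2) (\<psi> \<tau>\<^sub>1 \<tau>\<^sub>2) \<omega> = \<rho> \<tau> (\<tau>\<^sub>1 \<squnion>\<^sub>t \<tau>) (\<psi> \<tau>\<^sub>1 \<tau>) \<omega>"
proof -
  have "AE \<omega> in M. \<tau>\<^sub>2 \<omega> = \<tau> \<omega> \<longrightarrow>
      \<rho> \<tau>\<^sub>2 (\<tau>\<^sub>1 \<squnion>\<^sub>t \<tau>\<^sub>2) (\<psi> \<tau>\<^sub>1 \<tau>\<^sub>2) \<omega> = \<rho> \<tau> (\<tau>\<^sub>1 \<squnion>\<^sub>t \<tau>\<^sub>2) (\<psi> \<tau>\<^sub>1 \<tau>\<^sub>2) \<omega>"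
    using assms by (intro admissibility bermudan_max reward_Lp_stopped) auto
  moreover have "AE \<omega> in M. \<tau>\<^sub>2 \<omega> = \<tau> \<omega> \<longrightarrow>
      \<rho> \<tau>\<^sub>2 (\<tau>\<^sub>1 \<squnion>\<^sub>t \<tau>\<^sub>2) (\<psi> \<tau>\<^sub>1 \<tau>\<^sub>2) \<omega> = \<rho> \<tau> (\<tau>\<^sub>1 \<squnion>\<^sub>t \<tau>) (\<psi> \<tau>\<^sub>1 \<tau>) \<omega>"
    using zero_one_bis_2[OF bi_admissible bi_p_integrable assms(2,3,1)] .
  ultimately show ?thesis
    by eventually_elim simp
qed

text \<open>Once \<open>\<tau>\<^sub>2\<close> and \<open>\<sigma>\<^sub>2\<close> have been replaced by \<open>\<tau>\<close>, the two sides differ only in the first slot.\<close>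

lemma zero_one_second_time_now:
  assumes \<tau>: "\<tau> \<in> \<Theta>" and A: "A \<in> sets (stopped M F \<tau>)"
    and t: "\<tau>\<^sub>1 \<in> \<Theta>_from \<tau>" "\<tau>\<^sub>2 \<in> \<Theta>_from \<tau>" and s: "\<sigma>\<^sub>1 \<in> \<Theta>_from \<tau>" "\<sigma>\<^sub>2 \<in> \<Theta>_from \<tau>"
    and eq: "AE \<omega> in M. \<omega> \<in> A \<longrightarrow> \<tau>\<^sub>1 \<omega> = \<sigma>\<^sub>1 \<omega> \<and> \<tau>\<^sub>2 \<omega> = \<sigma>\<^sub>2 \<omega>"
  shows "AE \<omega> in M. \<omega> \<in> A \<and> \<tau>\<^sub>2 \<omega> = \<tau> \<omega> \<longrightarrow>
    \<rho> \<tau> (\<tau>\<^sub>1 \<squnion>\<^sub>t \<tau>\<^sub>2) (\<psi> \<tau>\<^sub>1 \<tau>\<^sub>2) \<omega> = \<rho> \<tau> (\<sigma>\<^sub>1 \<squnion>\<^sub>t \<sigma>\<^sub>2) (\<psi> \<sigma>\<^sub>1 \<sigma>\<^sub>2) \<omega>"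
proof -
  have \<Theta>: "\<tau>\<^sub>1 \<in> \<Theta>" "\<tau>\<^sub>2 \<in> \<Theta>" "\<sigma>\<^sub>1 \<in> \<Theta>" "\<sigma>\<^sub>2 \<in> \<Theta>"
    using t s by (simp_all add: bermudan_from_def)
  have "AE \<omega> in M. \<tau> \<omega> \<le> \<tau>\<^sub>1 \<omega>" "AE \<omega> in M. \<tau> \<omega> \<le> \<sigma>\<^sub>1 \<omega>"
    using t s by (simp_all add: bermudan_from_def)
  then have "AE \<omega> in M. max (\<tau>\<^sub>1 \<omega>) (\<tau> \<omega>) = \<tau>\<^sub>1 \<omega>" "AE \<omega> in M. max (\<sigma>\<^sub>1 \<omega>) (\<tau> \<omega>) = \<sigma>\<^sub>1 \<omega>"
    by auto
  moreover have "AE \<omega> in M. \<omega> \<in> A \<longrightarrow> \<tau>\<^sub>1 \<omega> = \<sigma>\<^sub>1 \<omega>"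
    using eq by auto
  ultimately have "AE \<omega> in M. \<omega> \<in> A \<longrightarrow>
      \<rho> \<tau> (\<tau>\<^sub>1 \<squnion>\<^sub>t \<tau>) (\<psi> \<tau>\<^sub>1 \<tau>) \<omega> = \<rho> \<tau> (\<sigma>\<^sub>1 \<squnion>\<^sub>t \<tau>) (\<psi> \<sigma>\<^sub>1 \<tau>) \<omega>"
    using \<tau> A t(1) s(1) \<Theta> by (intro zero_one_first_slot max_bermudan_from)
  with rho_second_time_now[OF \<tau> \<Theta>(1,2)] rho_second_time_now[OF \<tau> \<Theta>(3,4)] eq
  show ?thesis
    by eventually_elim auto
qed

section \<open>Pairs of stopping times whose minimum is now\<close>

definition initial_values :: "('a \<Rightarrow> real) \<Rightarrow> ('a \<Rightarrow> real) set"
  where "initial_values \<tau> = {\<rho> \<tau> (\<tau>\<^sub>1 \<squnion>\<^sub>t \<tau>\<^sub>2) (\<psi> \<tau>\<^sub>1 \<tau>\<^sub>2) | \<tau>\<^sub>1 \<tau>\<^sub>2.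
    \<tau>\<^sub>1 \<in> \<Theta> \<and> \<tau>\<^sub>2 \<in> \<Theta> \<and> (AE \<omega> in M. min (\<tau>\<^sub>1 \<omega>) (\<tau>\<^sub>2 \<omega>) = \<tau> \<omega>)}"

lemma initial_values_swap:
  "double_stopping.initial_values M F T \<theta> \<rho> (\<lambda>\<tau>\<^sub>1 \<tau>\<^sub>2. \<psi> \<tau>\<^sub>2 \<tau>\<^sub>1) \<tau> = initial_values \<tau>"
  unfolding double_stopping.initial_values_def[OF double_stopping_swap] initial_values_def
  by (intro Collect_cong, subst ex_comm) (simp add: max.commute min.commute conj_ac)

lemma initial_pair_from:
  assumes "\<tau>\<^sub>1 \<in> \<Theta>" "\<tau>\<^sub>2 \<in> \<Theta>" and min: "AE \<omega> in M. min (\<tau>\<^sub>1 \<omega>) (\<tau>\<^sub>2 \<omega>) = \<tau> \<omega>"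
  shows "\<tau>\<^sub>1 \<in> \<Theta>_from \<tau>" "\<tau>\<^sub>2 \<in> \<Theta>_from \<tau>"
proof -
  have "AE \<omega> in M. \<tau> \<omega> \<le> \<tau>\<^sub>1 \<omega>" "AE \<omega> in M. \<tau> \<omega> \<le> \<tau>\<^sub>2 \<omega>"
    using min by (auto elim!: eventually_mono)
  with assms show "\<tau>\<^sub>1 \<in> \<Theta>_from \<tau>" "\<tau>\<^sub>2 \<in> \<Theta>_from \<tau>"
    by (simp_all add: bermudan_from_def)
qed

text \<open>Almost surely one of the two times of an initial pair equals \<open>\<tau>\<close>. If it is the second, the
  preceding law applies; if it is the first, so does its twin for the exchanged reward.\<close>

lemma zero_one_initial:
  assumes \<tau>: "\<tau> \<in> \<Theta>" and A: "A \<in> sets (stopped M F \<tau>)"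
    and t: "\<tau>\<^sub>1 \<in> \<Theta>" "\<tau>\<^sub>2 \<in> \<Theta>" "AE \<omega> in M. min (\<tau>\<^sub>1 \<omega>) (\<tau>\<^sub>2 \<omega>) = \<tau> \<omega>"
    and s: "\<sigma>\<^sub>1 \<in> \<Theta>" "\<sigma>\<^sub>2 \<in> \<Theta>" "AE \<omega> in M. min (\<sigma>\<^sub>1 \<omega>) (\<sigma>\<^sub>2 \<omega>) = \<tau> \<omega>"
    and eq: "AE \<omega> in M. \<omega> \<in> A \<longrightarrow> \<tau>\<^sub>1 \<omega> = \<sigma>\<^sub>1 \<omega> \<and> \<tau>\<^sub>2 \<omega> = \<sigma>\<^sub>2 \<omega>"
  shows "AE \<omega> in M. \<omega> \<in> A \<longrightarrow>
    \<rho> \<tau> (\<tau>\<^sub>1 \<squnion>\<^sub>t \<tau>\<^sub>2) (\<psi> \<tau>\<^sub>1 \<tau>\<^sub>2) \<omega> = \<rho> \<tau> (\<sigma>\<^sub>1 \<squnion>\<^sub>t \<sigma>\<^sub>2) (\<psi> \<sigma>\<^sub>1 \<sigma>\<^sub>2) \<omega>"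
proof -
  have "AE \<omega> in M. \<omega> \<in> A \<longrightarrow> \<tau>\<^sub>2 \<omega> = \<sigma>\<^sub>2 \<omega> \<and> \<tau>\<^sub>1 \<omega> = \<sigma>\<^sub>1 \<omega>"
    using eq by eventually_elim simp
  from double_stopping.zero_one_second_time_now[OF double_stopping_swap \<tau> A
      initial_pair_from(2,1)[OF t] initial_pair_from(2,1)[OF s] this]
  have 1: "AE \<omega> in M. \<omega> \<in> A \<and> \<tau>\<^sub>1 \<omega> = \<tau> \<omega> \<longrightarrow>
      \<rho> \<tau> (\<tau>\<^sub>1 \<squnion>\<^sub>t \<tau>\<^sub>2) (\<psi> \<tau>\<^sub>1 \<tau>\<^sub>2) \<omega> = \<rho> \<tau> (\<sigma>\<^sub>1 \<squnion>\<^sub>t \<sigma>\<^sub>2) (\<psi> \<sigma>\<^sub>1 \<sigma>\<^sub>2) \<omega>"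
    by (simp add: max.commute)
  have 2: "AE \<omega> in M. \<omega> \<in> A \<and> \<tau>\<^sub>2 \<omega> = \<tau> \<omega> \<longrightarrow>
      \<rho> \<tau> (\<tau>\<^sub>1 \<squnion>\<^sub>t \<tau>\<^sub>2) (\<psi> \<tau>\<^sub>1 \<tau>\<^sub>2) \<omega> = \<rho> \<tau> (\<sigma>\<^sub>1 \<squnion>\<^sub>t \<sigma>\<^sub>2) (\<psi> \<sigma>\<^sub>1 \<sigma>\<^sub>2) \<omega>"
    by (rule zero_one_second_time_now[OF \<tau> A initial_pair_from[OF t] initial_pair_from[OF s] eq])
  show ?thesis
    using 1 2 t(3) by eventually_elim (auto simp: min_def split: if_splits)
qed

lemma initial_values_measurable: "\<tau> \<in> \<Theta> \<Longrightarrow> initial_values \<tau> \<subseteq> borel_measurable M"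
  by (auto simp: initial_values_def rho_reward_measurable)

text \<open>Paste the two pairs along the event where the first evaluation is the larger one. The pasted
  pair is again initial, and by the zero-one law its evaluation is the maximum of the two.\<close>

lemma initial_values_directed:
  assumes \<tau>: "\<tau> \<in> \<Theta>" and x: "x \<in> initial_values \<tau>" and y: "y \<in> initial_values \<tau>"
  shows "\<exists>z\<in>initial_values \<tau>. AE \<omega> in M. max (x \<omega>) (y \<omega>) \<le> z \<omega>"
proof -
  obtain \<tau>\<^sub>1 \<tau>\<^sub>2 where t: "\<tau>\<^sub>1 \<in> \<Theta>" "\<tau>\<^sub>2 \<in> \<Theta>" "AE \<omega> in M. min (\<tau>\<^sub>1 \<omega>) (\<tau>\<^sub>2 \<omega>) = \<tau> \<omega>"
    and x_eq: "x = \<rho> \<tau> (\<tau>\<^sub>1 \<squnion>\<^sub>t \<tau>\<^sub>2) (\<psi> \<tau>\<^sub>1 \<tau>\<^sub>2)"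
    using x by (auto simp: initial_values_def)
  obtain \<sigma>\<^sub>1 \<sigma>\<^sub>2 where s: "\<sigma>\<^sub>1 \<in> \<Theta>" "\<sigma>\<^sub>2 \<in> \<Theta>" "AE \<omega> in M. min (\<sigma>\<^sub>1 \<omega>) (\<sigma>\<^sub>2 \<omega>) = \<tau> \<omega>"
    and y_eq: "y = \<rho> \<tau> (\<sigma>\<^sub>1 \<squnion>\<^sub>t \<sigma>\<^sub>2) (\<psi> \<sigma>\<^sub>1 \<sigma>\<^sub>2)"
    using y by (auto simp: initial_values_def)
  define A where "A = {\<omega>\<in>space (stopped M F \<tau>). y \<omega> \<le> x \<omega>}"
  have A: "A \<in> sets (stopped M F \<tau>)"
    unfolding A_def x_eq y_eq using rho_reward_Lp[OF \<tau>] t s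
    by (intro borel_measurable_le) (auto simp: Lp_def)
  define \<nu>\<^sub>1 where "\<nu>\<^sub>1 = (\<lambda>\<omega>. if \<omega> \<in> A then \<tau>\<^sub>1 \<omega> else \<sigma>\<^sub>1 \<omega>)"
  define \<nu>\<^sub>2 where "\<nu>\<^sub>2 = (\<lambda>\<omega>. if \<omega> \<in> A then \<tau>\<^sub>2 \<omega> else \<sigma>\<^sub>2 \<omega>)"
  have n: "\<nu>\<^sub>1 \<in> \<Theta>" "\<nu>\<^sub>2 \<in> \<Theta>"
    unfolding \<nu>\<^sub>1_def \<nu>\<^sub>2_def using initial_pair_from[OF t] initial_pair_from[OF s]
    by (auto intro: bermudan_from_bermudan bermudan_If[OF \<tau> A])
  have n_min: "AE \<omega> in M. min (\<nu>\<^sub>1 \<omega>) (\<nu>\<^sub>2 \<omega>) = \<tau> \<omega>"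
    using t(3) s(3) by eventually_elim (simp add: \<nu>\<^sub>1_def \<nu>\<^sub>2_def)
  define z where "z = \<rho> \<tau> (\<nu>\<^sub>1 \<squnion>\<^sub>t \<nu>\<^sub>2) (\<psi> \<nu>\<^sub>1 \<nu>\<^sub>2)"
  have "AE \<omega> in M. \<omega> \<in> A \<longrightarrow> z \<omega> = x \<omega>"
    unfolding z_def x_eq by (rule zero_one_initial[OF \<tau> A n n_min t]) (auto simp: \<nu>\<^sub>1_def \<nu>\<^sub>2_def)
  moreover have "AE \<omega> in M. \<omega> \<in> space (stopped M F \<tau>) - A \<longrightarrow> z \<omega> = y \<omega>"
    unfolding z_def y_eq
    by (rule zero_one_initial[OF \<tau> sets.compl_sets[OF A] n n_min s]) (auto simp: \<nu>\<^sub>1_def \<nu>\<^sub>2_def)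
  ultimately have "AE \<omega> in M. max (x \<omega>) (y \<omega>) \<le> z \<omega>"
    using AE_space by eventually_elim (auto simp: A_def space_pre_sigma)
  moreover have "z \<in> initial_values \<tau>"
    using n n_min by (auto simp: initial_values_def z_def)
  ultimately show ?thesis
    by blast
qed

end

section \<open>The new reward as a supremum over initial pairs\<close>

context double_stopping
begin

abbreviation "V \<equiv> double_value M F T \<theta> \<rho> \<psi>"
abbreviation "v\<^sub>1 \<equiv> value_1 M F T \<theta> \<rho> \<psi>"
abbreviation "v\<^sub>2 \<equiv> value_2 M F T \<theta> \<rho> \<psi>"
abbreviation "\<phi> \<equiv> new_reward M F T \<theta> \<rho> \<psi>"

lemma value_1_swap: "value_1 M F T \<theta> \<rho> (\<lambda>\<tau>\<^sub>1 \<tau>\<^sub>2. \<psi> \<tau>\<^sub>2 \<tau>\<^sub>1) = v\<^sub>2"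
  by (intro ext) (simp add: value_1_def value_2_def)

text \<open>The definition of \<open>v\<^sub>1\<close> indexes the operator by \<open>\<sigma>\<close>, that of \<open>V\<close> by the a.s. equal function
  \<open>\<sigma> \<squnion> \<tau>\<close>; this lemma passes from one to the other.\<close>

lemma rho_reward_first_slot:
  assumes \<tau>: "\<tau> \<in> \<Theta>" and \<sigma>: "\<sigma> \<in> \<Theta>_from \<tau>"
  shows "AE \<omega> in M. \<rho> \<tau> \<sigma> (\<psi> \<sigma> \<tau>) \<omega> = \<rho> \<tau> (\<sigma> \<squnion>\<^sub>t \<tau>) (\<psi> \<sigma> \<tau>) \<omega>"
proof -
  have \<Theta>: "\<sigma> \<in> \<Theta>" "AE \<omega> in M. \<tau> \<omega> \<le> \<sigma> \<omega>"
    using \<sigma> by (simp_all add: bermudan_from_def)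
  from \<Theta>(2) have eq: "AE \<omega> in M. max (\<sigma> \<omega>) (\<tau> \<omega>) = \<sigma> \<omega>"
    by eventually_elim simp
  have "AE \<omega> in M. \<omega> \<in> space (stopped M F \<tau>) \<longrightarrow>
      \<rho> \<tau> \<sigma> (\<psi> \<sigma> \<tau>) \<omega> = \<rho> \<tau> (\<sigma> \<squnion>\<^sub>t \<tau>) (\<psi> \<sigma> \<tau>) \<omega>"
    by (rule zero_one_first_slot[OF \<tau> sets.top \<sigma> \<sigma> \<sigma> _ max_bermudan_from[OF \<tau> \<Theta>(1)] eq]) simp_all
  with AE_space show ?thesis
    by eventually_elim (simp add: space_pre_sigma)
qed

lemma value_1_family_measurable:
  assumes \<tau>: "\<tau> \<in> \<Theta>"
  shows "{\<rho> \<tau> \<sigma> (\<psi> \<sigma> \<tau>) | \<sigma>. \<sigma> \<in> \<Theta>_from \<tau>} \<subseteq> borel_measurable M"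
proof safe
  fix \<sigma> assume "\<sigma> \<in> \<Theta>_from \<tau>"
  then have \<sigma>: "\<sigma> \<in> \<Theta>" "AE \<omega> in M. \<tau> \<omega> \<le> \<sigma> \<omega>"
    by (simp_all add: bermudan_from_def)
  then have "AE \<omega> in M. max (\<sigma> \<omega>) (\<tau> \<omega>) \<le> \<sigma> \<omega>"
    by (auto elim!: eventually_mono)
  then show "\<rho> \<tau> \<sigma> (\<psi> \<sigma> \<tau>) \<in> borel_measurable M"
    using \<sigma> \<tau> by (intro Lp_stopped_measurable[where p = p, OF \<tau>] rho_Lp reward_Lp_stopped)
qed

lemma value_1_le_ess_sup_initial_values:
  assumes \<tau>: "\<tau> \<in> \<Theta>"
  shows "AE \<omega> in M. v\<^sub>1 \<tau> \<omega> \<le> ess_sup M (initial_values \<tau>) \<omega>"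
  unfolding value_1_def
proof (rule ess_sup_least[OF value_1_family_measurable[OF \<tau>]
      measurable_ess_sup[OF initial_values_measurable[OF \<tau>]]])
  fix x assume "x \<in> {\<rho> \<tau> \<sigma> (\<psi> \<sigma> \<tau>) | \<sigma>. \<sigma> \<in> \<Theta>_from \<tau>}"
  then obtain \<sigma> where \<sigma>: "\<sigma> \<in> \<Theta>_from \<tau>" and x: "x = \<rho> \<tau> \<sigma> (\<psi> \<sigma> \<tau>)"
    by blast
  have "AE \<omega> in M. min (\<sigma> \<omega>) (\<tau> \<omega>) = \<tau> \<omega>"
    using \<sigma> by (auto simp: bermudan_from_def elim!: eventually_mono)
  then have "\<rho> \<tau> (\<sigma> \<squnion>\<^sub>t \<tau>) (\<psi> \<sigma> \<tau>) \<in> initial_values \<tau>"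
    using \<tau> \<sigma> bermudan_from_bermudan by (auto simp: initial_values_def)
  from ess_sup_upper[OF initial_values_measurable[OF \<tau>] this] rho_reward_first_slot[OF \<tau> \<sigma>]
  show "AE \<omega> in M. ereal (x \<omega>) \<le> ess_sup M (initial_values \<tau>) \<omega>"
    unfolding x by eventually_elim simp
qed

lemma initial_value_le_value_1:
  assumes \<tau>: "\<tau> \<in> \<Theta>" and t: "\<tau>\<^sub>1 \<in> \<Theta>_from \<tau>" "\<tau>\<^sub>2 \<in> \<Theta>"
  shows "AE \<omega> in M. \<tau>\<^sub>2 \<omega> = \<tau> \<omega> \<longrightarrow> ereal (\<rho> \<tau> (\<tau>\<^sub>1 \<squnion>\<^sub>t \<tau>\<^sub>2) (\<psi> \<tau>\<^sub>1 \<tau>\<^sub>2) \<omega>) \<le> v\<^sub>1 \<tau> \<omega>"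
proof -
  have "AE \<omega> in M. ereal (\<rho> \<tau> \<tau>\<^sub>1 (\<psi> \<tau>\<^sub>1 \<tau>) \<omega>) \<le> v\<^sub>1 \<tau> \<omega>"
    unfolding value_1_def using t by (intro ess_sup_upper[OF value_1_family_measurable[OF \<tau>]]) auto
  with rho_reward_first_slot[OF \<tau> t(1)] rho_second_time_now[OF \<tau> bermudan_from_bermudan[OF t(1)] t(2)]
  show ?thesis
    by eventually_elim simp
qed

lemma new_reward_eq_ess_sup_initial_values:
  assumes \<tau>: "\<tau> \<in> \<Theta>"
  shows "AE \<omega> in M. \<phi> \<tau> \<omega> = ess_sup M (initial_values \<tau>) \<omega>"
proof -
  interpret swap: double_stopping M F T \<theta> p \<rho> "\<lambda>\<tau>\<^sub>1 \<tau>\<^sub>2. \<psi> \<tau>\<^sub>2 \<tau>\<^sub>1"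
    by (rule double_stopping_swap)
  have meas: "v\<^sub>1 \<tau> \<in> borel_measurable M" "v\<^sub>2 \<tau> \<in> borel_measurable M"
    using measurable_ess_sup[OF value_1_family_measurable[OF \<tau>]]
      measurable_ess_sup[OF swap.value_1_family_measurable[OF \<tau>]]
    by (simp_all add: value_1_def value_2_def)
  have "AE \<omega> in M. ess_sup M (initial_values \<tau>) \<omega> \<le> \<phi> \<tau> \<omega>"
  proof (rule ess_sup_least[OF initial_values_measurable[OF \<tau>]])
    show "\<phi> \<tau> \<in> borel_measurable M"
      unfolding new_reward_def using meas by simp
    fix x assume "x \<in> initial_values \<tau>"
    then obtain \<tau>\<^sub>1 \<tau>\<^sub>2 where t: "\<tau>\<^sub>1 \<in> \<Theta>" "\<tau>\<^sub>2 \<in> \<Theta>" "AE \<omega> in M. min (\<tau>\<^sub>1 \<omega>) (\<tau>\<^sub>2 \<omega>) = \<tau> \<omega>"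
      and x: "x = \<rho> \<tau> (\<tau>\<^sub>1 \<squnion>\<^sub>t \<tau>\<^sub>2) (\<psi> \<tau>\<^sub>1 \<tau>\<^sub>2)"
      by (auto simp: initial_values_def)
    have "AE \<omega> in M. \<tau>\<^sub>2 \<omega> = \<tau> \<omega> \<longrightarrow> ereal (x \<omega>) \<le> v\<^sub>1 \<tau> \<omega>"
      unfolding x using \<tau> initial_pair_from[OF t] t by (intro initial_value_le_value_1)
    moreover have "AE \<omega> in M. \<tau>\<^sub>1 \<omega> = \<tau> \<omega> \<longrightarrow> ereal (x \<omega>) \<le> v\<^sub>2 \<tau> \<omega>"
      using swap.initial_value_le_value_1[OF \<tau> initial_pair_from(2)[OF t] t(1)]
      unfolding x by (simp add: value_1_swap max.commute)
    ultimately show "AE \<omega> in M. ereal (x \<omega>) \<le> \<phi> \<tau> \<omega>"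
      using t(3)
      by eventually_elim (auto simp: new_reward_def min_def le_max_iff_disj split: if_splits)
  qed
  moreover have "AE \<omega> in M. v\<^sub>1 \<tau> \<omega> \<le> ess_sup M (initial_values \<tau>) \<omega>"
    by (rule value_1_le_ess_sup_initial_values[OF \<tau>])
  moreover have "AE \<omega> in M. v\<^sub>2 \<tau> \<omega> \<le> ess_sup M (initial_values \<tau>) \<omega>"
    using swap.value_1_le_ess_sup_initial_values[OF \<tau>] by (simp add: value_1_swap initial_values_swap)
  ultimately show ?thesis
    by eventually_elim (simp add: new_reward_def order.antisym)
qed

lemma double_value_family_measurable:
  "S \<in> \<Theta> \<Longrightarrow> {\<rho> S (\<tau>\<^sub>1 \<squnion>\<^sub>t \<tau>\<^sub>2) (\<psi> \<tau>\<^sub>1 \<tau>\<^sub>2) | \<tau>\<^sub>1 \<tau>\<^sub>2. \<tau>\<^sub>1 \<in> \<Theta>_from S \<and> \<tau>\<^sub>2 \<in> \<Theta>_from S}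
    \<subseteq> borel_measurable M"
  by (auto intro!: rho_reward_measurable dest: bermudan_from_bermudan)

lemma rho_reward_le_double_value:
  "S \<in> \<Theta> \<Longrightarrow> \<tau>\<^sub>1 \<in> \<Theta>_from S \<Longrightarrow> \<tau>\<^sub>2 \<in> \<Theta>_from S \<Longrightarrow>
    AE \<omega> in M. ereal (\<rho> S (\<tau>\<^sub>1 \<squnion>\<^sub>t \<tau>\<^sub>2) (\<psi> \<tau>\<^sub>1 \<tau>\<^sub>2) \<omega>) \<le> V S \<omega>"
  unfolding double_value_def by (intro ess_sup_upper double_value_family_measurable) auto

lemma new_reward_le_double_value:
  assumes \<tau>: "\<tau> \<in> \<Theta>"
  shows "AE \<omega> in M. \<phi> \<tau> \<omega> \<le> V \<tau> \<omega>"
proof -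
  have "AE \<omega> in M. ess_sup M (initial_values \<tau>) \<omega> \<le> V \<tau> \<omega>"
  proof (rule ess_sup_least[OF initial_values_measurable[OF \<tau>]])
    show "V \<tau> \<in> borel_measurable M"
      unfolding double_value_def by (intro measurable_ess_sup double_value_family_measurable \<tau>)
    show "AE \<omega> in M. ereal (x \<omega>) \<le> V \<tau> \<omega>" if "x \<in> initial_values \<tau>" for x
      using that initial_pair_from unfolding initial_values_def
      by (elim CollectE exE conjE) (simp only: rho_reward_le_double_value[OF \<tau>])
  qed
  with new_reward_eq_ess_sup_initial_values[OF \<tau>] show ?thesis
    by eventually_elim simp
qed

section \<open>Equality of the single and the double value\<close>

text \<open>The value \<open>V(\<tau>)\<close> bounds \<open>\<phi>(\<tau>)\<close> from above and the terms of the sequence bound it from below, so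
  \<open>\<phi>(\<tau>)\<close> is finite and its conversion to a real number loses nothing.\<close>

lemma new_reward_approximation:
  assumes \<tau>: "\<tau> \<in> \<Theta>" and fin: "AE \<omega> in M. V \<tau> \<omega> < \<infinity>"
  obtains w where "\<forall>n. w n \<in> initial_values \<tau>" "AE \<omega> in M. incseq (\<lambda>n. w n \<omega>)"
    "AE \<omega> in M. (\<lambda>n. w n \<omega>) \<longlonglongrightarrow> real_of_ereal (\<phi> \<tau> \<omega>)"
    "AE \<omega> in M. w 0 \<omega> \<le> real_of_ereal (\<phi> \<tau> \<omega>)"
    "AE \<omega> in M. \<phi> \<tau> \<omega> = ereal (real_of_ereal (\<phi> \<tau> \<omega>))"
proof -
  have "\<rho> \<tau> (\<tau> \<squnion>\<^sub>t \<tau>) (\<psi> \<tau> \<tau>) \<in> initial_values \<tau>"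
    unfolding initial_values_def mem_Collect_eq by (intro exI[of _ \<tau>] conjI refl \<tau>) simp
  then have ne: "initial_values \<tau> \<noteq> {}"
    by blast
  obtain w where w: "\<forall>n. w n \<in> initial_values \<tau>" "AE \<omega> in M. incseq (\<lambda>n. w n \<omega>)"
    "AE \<omega> in M. (SUP n. ereal (w n \<omega>)) = ess_sup M (initial_values \<tau>) \<omega>"
    by (rule ess_sup_directed[OF initial_values_measurable[OF \<tau>] ne initial_values_directed[OF \<tau>]])
  have lim: "AE \<omega> in M. (\<phi> \<tau> \<omega> = ereal (real_of_ereal (\<phi> \<tau> \<omega>)) \<and> w 0 \<omega> \<le> real_of_ereal (\<phi> \<tau> \<omega>)) \<and>
      (\<lambda>n. w n \<omega>) \<longlonglongrightarrow> real_of_ereal (\<phi> \<tau> \<omega>)"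
    using w(2,3) fin new_reward_eq_ess_sup_initial_values[OF \<tau>] new_reward_le_double_value[OF \<tau>]
  proof eventually_elim
    case (elim \<omega>)
    have \<phi>: "(SUP n. ereal (w n \<omega>)) = \<phi> \<tau> \<omega>"
      using elim by simp
    have w0: "ereal (w 0 \<omega>) \<le> \<phi> \<tau> \<omega>"
      unfolding \<phi>[symmetric] by (rule SUP_upper) simp
    moreover have "\<phi> \<tau> \<omega> < \<infinity>"
      using elim by (auto intro: le_less_trans)
    ultimately obtain r where r: "\<phi> \<tau> \<omega> = ereal r"
      by (cases "\<phi> \<tau> \<omega>") auto
    have "(\<lambda>n. ereal (w n \<omega>)) \<longlonglongrightarrow> \<phi> \<tau> \<omega>"
      unfolding \<phi>[symmetric] using elim(1) by (intro LIMSEQ_SUP) (auto simp: incseq_def)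
    then show ?case
      using w0 by (simp add: r)
  qed
  show thesis
    by (rule that[OF w(1,2)]) (use lim in \<open>auto elim!: eventually_mono\<close>)
qed

text \<open>Measurability for the sigma-algebra stopped at \<open>\<tau>\<close> comes from the approximating sequence, since
  \<open>\<phi>(\<tau>)\<close> itself is only built from essential suprema over \<open>M\<close>; integrability comes from squeezing
  \<open>\<phi>(\<tau>)\<close> between the first term of that sequence and \<open>V(\<tau>)\<close>.\<close>

lemma new_reward_Lp:
  assumes \<tau>: "\<tau> \<in> \<Theta>" and fin: "AE \<omega> in M. V \<tau> \<omega> < \<infinity>"
    and V: "(\<lambda>\<omega>. real_of_ereal (V \<tau> \<omega>)) \<in> Lp M p M"
  shows "(\<lambda>\<omega>. real_of_ereal (\<phi> \<tau> \<omega>)) \<in> Lp M p (stopped M F \<tau>)"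
proof -
  obtain w where w: "\<forall>n. w n \<in> initial_values \<tau>" "AE \<omega> in M. incseq (\<lambda>n. w n \<omega>)"
    "AE \<omega> in M. (\<lambda>n. w n \<omega>) \<longlonglongrightarrow> real_of_ereal (\<phi> \<tau> \<omega>)"
    "AE \<omega> in M. w 0 \<omega> \<le> real_of_ereal (\<phi> \<tau> \<omega>)"
    and real: "AE \<omega> in M. \<phi> \<tau> \<omega> = ereal (real_of_ereal (\<phi> \<tau> \<omega>))"
    by (rule new_reward_approximation[OF \<tau> fin])
  have sub: "subalgebra M (stopped M F \<tau>)"
    by (rule subalgebra_stopped[OF bermudan_stopping_times[OF \<tau>]])
  have w_Lp: "w n \<in> Lp M p (stopped M F \<tau>)" for n
    using spec[OF w(1), of n] rho_reward_Lp[OF \<tau>] by (auto simp: initial_values_def)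
  have "(\<lambda>\<omega>. lim (\<lambda>n. w n \<omega>)) \<in> borel_measurable (stopped M F \<tau>)"
    using w_Lp by (intro borel_measurable_lim_metric) (simp add: Lp_def)
  moreover have "AE \<omega> in M. real_of_ereal (\<phi> \<tau> \<omega>) = lim (\<lambda>n. w n \<omega>)"
    using w(3) by eventually_elim (simp add: limI)
  ultimately have "(\<lambda>\<omega>. real_of_ereal (\<phi> \<tau> \<omega>)) \<in> borel_measurable (stopped M F \<tau>)"
    by (rule measurable_stopped_AE_cong[OF bermudan_stopping_times[OF \<tau>]])
  moreover have "AE \<omega> in M. \<bar>real_of_ereal (\<phi> \<tau> \<omega>)\<bar> \<le> max \<bar>w 0 \<omega>\<bar> \<bar>real_of_ereal (V \<tau> \<omega>)\<bar>"
    using w(4) real fin new_reward_le_double_value[OF \<tau>]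
  proof eventually_elim
    case (elim \<omega>)
    have "real_of_ereal (\<phi> \<tau> \<omega>) \<le> real_of_ereal (V \<tau> \<omega>)"
      using elim(2-4) by (cases "V \<tau> \<omega>"; cases "\<phi> \<tau> \<omega>") auto
    with elim(1) show ?case
      by linarith
  qed
  ultimately show ?thesis
    by (rule Lp_dominated[OF sub _ Lp_subalgebra[OF sub w_Lp] V])
qed

text \<open>A pair that is initial for \<open>\<tau> \<ge> S\<close> is among those over which \<open>V(S)\<close> is taken. Consistency and the
  monotone Fatou property carry this bound from the approximating sequence to \<open>\<phi>(\<tau>)\<close>.\<close>

lemma rho_new_reward_le_double_value:
  assumes S: "S \<in> \<Theta>" and \<tau>: "\<tau> \<in> \<Theta>_from S" and fin: "AE \<omega> in M. V \<tau> \<omega> < \<infinity>"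
    and V: "(\<lambda>\<omega>. real_of_ereal (V \<tau> \<omega>)) \<in> Lp M p M"
  shows "AE \<omega> in M. ereal (\<rho> S \<tau> (\<lambda>\<omega>. real_of_ereal (\<phi> \<tau> \<omega>)) \<omega>) \<le> V S \<omega>"
proof -
  have \<tau>': "\<tau> \<in> \<Theta>" "AE \<omega> in M. S \<omega> \<le> \<tau> \<omega>"
    using \<tau> by (simp_all add: bermudan_from_def)
  obtain w where w: "\<forall>n. w n \<in> initial_values \<tau>" "AE \<omega> in M. incseq (\<lambda>n. w n \<omega>)"
    "AE \<omega> in M. (\<lambda>n. w n \<omega>) \<longlonglongrightarrow> real_of_ereal (\<phi> \<tau> \<omega>)"
    "AE \<omega> in M. w 0 \<omega> \<le> real_of_ereal (\<phi> \<tau> \<omega>)"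
    "AE \<omega> in M. \<phi> \<tau> \<omega> = ereal (real_of_ereal (\<phi> \<tau> \<omega>))"
    by (rule new_reward_approximation[OF \<tau>'(1) fin])
  have w_Lp: "w n \<in> Lp M p (stopped M F \<tau>)" for n
    using spec[OF w(1), of n] rho_reward_Lp[OF \<tau>'(1)] by (auto simp: initial_values_def)
  have "AE \<omega> in M. ereal (\<rho> S \<tau> (w n) \<omega>) \<le> V S \<omega>" for n
  proof -
    obtain \<tau>\<^sub>1 \<tau>\<^sub>2 where t: "\<tau>\<^sub>1 \<in> \<Theta>" "\<tau>\<^sub>2 \<in> \<Theta>" "AE \<omega> in M. min (\<tau>\<^sub>1 \<omega>) (\<tau>\<^sub>2 \<omega>) = \<tau> \<omega>"
      and wn: "w n = \<rho> \<tau> (\<tau>\<^sub>1 \<squnion>\<^sub>t \<tau>\<^sub>2) (\<psi> \<tau>\<^sub>1 \<tau>\<^sub>2)"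
      using spec[OF w(1), of n] by (auto simp: initial_values_def)
    have le: "AE \<omega> in M. S \<omega> \<le> \<tau>\<^sub>1 \<omega>" "AE \<omega> in M. S \<omega> \<le> \<tau>\<^sub>2 \<omega>" "AE \<omega> in M. \<tau> \<omega> \<le> max (\<tau>\<^sub>1 \<omega>) (\<tau>\<^sub>2 \<omega>)"
      using t(3) \<tau>'(2) by (eventually_elim, simp)+
    have "AE \<omega> in M. \<rho> S \<tau> (w n) \<omega> = \<rho> S (\<tau>\<^sub>1 \<squnion>\<^sub>t \<tau>\<^sub>2) (\<psi> \<tau>\<^sub>1 \<tau>\<^sub>2) \<omega>"
      unfolding wn using S \<tau>' t le(3) by (intro consistency bermudan_max reward_Lp_stopped) auto
    moreover have "AE \<omega> in M. ereal (\<rho> S (\<tau>\<^sub>1 \<squnion>\<^sub>t \<tau>\<^sub>2) (\<psi> \<tau>\<^sub>1 \<tau>\<^sub>2) \<omega>) \<le> V S \<omega>"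
      using t le by (intro rho_reward_le_double_value[OF S]) (simp_all add: bermudan_from_def)
    ultimately show ?thesis
      by eventually_elim simp
  qed
  then have "AE \<omega> in M. \<forall>n. ereal (\<rho> S \<tau> (w n) \<omega>) \<le> V S \<omega>"
    by (simp add: AE_all_countable)
  moreover have "AE \<omega> in M. ereal (\<rho> S \<tau> (\<lambda>\<omega>. real_of_ereal (\<phi> \<tau> \<omega>)) \<omega>) \<le>
      liminf (\<lambda>n. ereal (\<rho> S \<tau> (w n) \<omega>))"
    by (rule monotone_fatou[OF S \<tau>'(1) w_Lp new_reward_Lp[OF \<tau>'(1) fin V] w(2,3)])
  ultimately show ?thesis
  proof eventually_elim
    case (elim \<omega>)
    have "liminf (\<lambda>n. ereal (\<rho> S \<tau> (w n) \<omega>)) \<le> V S \<omega>"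
      using elim(1) by (intro Liminf_le) simp_all
    with elim(2) show ?case
      by (rule order.trans)
  qed
qed

text \<open>The pair \<open>(\<tau>\<^sub>1, \<tau>\<^sub>2)\<close> is initial for its own minimum, so its evaluation there is bounded by the new
  reward; consistency transports the bound back to \<open>S\<close>.\<close>

lemma rho_reward_le_rho_new_reward:
  assumes S: "S \<in> \<Theta>" and t: "\<tau>\<^sub>1 \<in> \<Theta>_from S" "\<tau>\<^sub>2 \<in> \<Theta>_from S"
    and fin: "AE \<omega> in M. V (\<tau>\<^sub>1 \<sqinter>\<^sub>t \<tau>\<^sub>2) \<omega> < \<infinity>"
    and V: "(\<lambda>\<omega>. real_of_ereal (V (\<tau>\<^sub>1 \<sqinter>\<^sub>t \<tau>\<^sub>2) \<omega>)) \<in> Lp M p M"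
  shows "AE \<omega> in M. \<rho> S (\<tau>\<^sub>1 \<squnion>\<^sub>t \<tau>\<^sub>2) (\<psi> \<tau>\<^sub>1 \<tau>\<^sub>2) \<omega> \<le>
    \<rho> S (\<tau>\<^sub>1 \<sqinter>\<^sub>t \<tau>\<^sub>2) (\<lambda>\<omega>. real_of_ereal (\<phi> (\<tau>\<^sub>1 \<sqinter>\<^sub>t \<tau>\<^sub>2) \<omega>)) \<omega>"
proof -
  define m where "m = \<tau>\<^sub>1 \<sqinter>\<^sub>t \<tau>\<^sub>2"
  define x where "x = \<rho> m (\<tau>\<^sub>1 \<squnion>\<^sub>t \<tau>\<^sub>2) (\<psi> \<tau>\<^sub>1 \<tau>\<^sub>2)"
  have \<Theta>: "\<tau>\<^sub>1 \<in> \<Theta>" "\<tau>\<^sub>2 \<in> \<Theta>" "m \<in> \<Theta>"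
    using t by (auto simp: m_def bermudan_min bermudan_from_def)
  have "AE \<omega> in M. S \<omega> \<le> \<tau>\<^sub>1 \<omega>" "AE \<omega> in M. S \<omega> \<le> \<tau>\<^sub>2 \<omega>"
    using t by (simp_all add: bermudan_from_def)
  then have le: "AE \<omega> in M. S \<omega> \<le> m \<omega>"
    unfolding m_def by eventually_elim simp
  have "AE \<omega> in M. \<rho> S m x \<omega> = \<rho> S (\<tau>\<^sub>1 \<squnion>\<^sub>t \<tau>\<^sub>2) (\<psi> \<tau>\<^sub>1 \<tau>\<^sub>2) \<omega>"
    unfolding x_def using S \<Theta> le
    by (intro consistency bermudan_max reward_Lp_stopped) (auto simp: m_def)
  moreover have "AE \<omega> in M. \<rho> S m x \<omega> \<le> \<rho> S m (\<lambda>\<omega>. real_of_ereal (\<phi> m \<omega>)) \<omega>"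
  proof (rule monotonicity[OF S \<Theta>(3)])
    show "x \<in> Lp M p (stopped M F m)"
      unfolding x_def using \<Theta> by (intro rho_reward_Lp)
    show "(\<lambda>\<omega>. real_of_ereal (\<phi> m \<omega>)) \<in> Lp M p (stopped M F m)"
      using new_reward_Lp[OF \<Theta>(3)] fin V by (simp add: m_def)
    have "x \<in> initial_values m"
      unfolding x_def initial_values_def using \<Theta> by (auto simp: m_def)
    from ess_sup_upper[OF initial_values_measurable[OF \<Theta>(3)] this]
    have "AE \<omega> in M. ereal (x \<omega>) \<le> \<phi> m \<omega>"
      using new_reward_eq_ess_sup_initial_values[OF \<Theta>(3)] by eventually_elim simp
    moreover have "AE \<omega> in M. \<phi> m \<omega> < \<infinity>"
      using fin new_reward_le_double_value[OF \<Theta>(3)] unfolding m_def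
      by eventually_elim (rule le_less_trans)
    ultimately show "AE \<omega> in M. x \<omega> \<le> real_of_ereal (\<phi> m \<omega>)"
    proof eventually_elim
      case (elim \<omega>)
      then show ?case
        by (cases "\<phi> m \<omega>") auto
    qed
  qed
  ultimately show ?thesis
    unfolding m_def by eventually_elim simp
qed

end

theorem theorem1:
  fixes M :: "'a measure" and F :: "real \<Rightarrow> 'a measure" and T :: real
    and \<theta> :: "nat \<Rightarrow> 'a \<Rightarrow> real" and p :: ennreal
    and \<rho> :: "('a \<Rightarrow> real) \<Rightarrow> ('a \<Rightarrow> real) \<Rightarrow> ('a \<Rightarrow> real) \<Rightarrow> 'a \<Rightarrow> real"
    and \<psi> :: "('a \<Rightarrow> real) \<Rightarrow> ('a \<Rightarrow> real) \<Rightarrow> 'a \<Rightarrow> real"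
  assumes "bermudan_evaluation M F T \<theta> p \<rho>"
    and "bi_admissible M F T \<theta> \<psi>"
    and "bi_p_integrable M F T \<theta> p \<psi>"
    and "\<And>S. S \<in> bermudan M F T \<theta> \<Longrightarrow>
      (AE \<omega> in M. \<bar>double_value M F T \<theta> \<rho> \<psi> S \<omega>\<bar> \<noteq> \<infinity>) \<and>
      (\<lambda>\<omega>. real_of_ereal (double_value M F T \<theta> \<rho> \<psi> S \<omega>)) \<in> Lp M p M"
  shows "\<forall>S\<in>bermudan M F T \<theta>.
    AE \<omega> in M. single_value M F T \<theta> \<rho> \<psi> S \<omega> = double_value M F T \<theta> \<rho> \<psi> S \<omega>"
proof
  interpret bermudan_evaluation M F T \<theta> p \<rho>
    by fact
  interpret double_stopping M F T \<theta> p \<rho> \<psi>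
    by unfold_locales fact+
  have fin: "AE \<omega> in M. V S \<omega> < \<infinity>" if "S \<in> \<Theta>" for S
    using conjunct1[OF assms(4)[OF that]] by eventually_elim auto
  have Lp: "(\<lambda>\<omega>. real_of_ereal (V S \<omega>)) \<in> Lp M p M" if "S \<in> \<Theta>" for S
    using assms(4)[OF that] by blast
  fix S assume S: "S \<in> \<Theta>"
  let ?U = "{\<rho> S \<tau> (\<lambda>\<omega>. real_of_ereal (\<phi> \<tau> \<omega>)) | \<tau>. \<tau> \<in> \<Theta>_from S}"
  have U: "?U \<subseteq> borel_measurable M"
    using S fin Lp
    by (auto intro!: Lp_stopped_measurable[where p = p, OF S] rho_Lp new_reward_Lp dest: bermudan_from_bermudan)
  have meas: "V S \<in> borel_measurable M" "ess_sup M ?U \<in> borel_measurable M"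
    unfolding double_value_def
    by (intro measurable_ess_sup U double_value_family_measurable S)+
  have "AE \<omega> in M. ess_sup M ?U \<omega> \<le> V S \<omega>"
  proof (rule ess_sup_least[OF U meas(1)])
    fix x assume "x \<in> ?U"
    then obtain \<tau> where \<tau>: "\<tau> \<in> \<Theta>_from S" and x: "x = \<rho> S \<tau> (\<lambda>\<omega>. real_of_ereal (\<phi> \<tau> \<omega>))"
      by blast
    show "AE \<omega> in M. ereal (x \<omega>) \<le> V S \<omega>"
      unfolding x using bermudan_from_bermudan[OF \<tau>]
      by (intro rho_new_reward_le_double_value S \<tau> fin Lp)
  qed
  moreover have "AE \<omega> in M. V S \<omega> \<le> ess_sup M ?U \<omega>"
    unfolding double_value_def
  proof (rule ess_sup_least[OF double_value_family_measurable[OF S] meas(2)])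
    fix x assume "x \<in> {\<rho> S (\<tau>\<^sub>1 \<squnion>\<^sub>t \<tau>\<^sub>2) (\<psi> \<tau>\<^sub>1 \<tau>\<^sub>2) | \<tau>\<^sub>1 \<tau>\<^sub>2. \<tau>\<^sub>1 \<in> \<Theta>_from S \<and> \<tau>\<^sub>2 \<in> \<Theta>_from S}"
    then obtain \<tau>\<^sub>1 \<tau>\<^sub>2 where t: "\<tau>\<^sub>1 \<in> \<Theta>_from S" "\<tau>\<^sub>2 \<in> \<Theta>_from S"
      and x: "x = \<rho> S (\<tau>\<^sub>1 \<squnion>\<^sub>t \<tau>\<^sub>2) (\<psi> \<tau>\<^sub>1 \<tau>\<^sub>2)"
      by blast
    have m: "\<tau>\<^sub>1 \<sqinter>\<^sub>t \<tau>\<^sub>2 \<in> \<Theta>"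
      using t by (simp add: bermudan_from_def bermudan_min)
    have "AE \<omega> in M. S \<omega> \<le> \<tau>\<^sub>1 \<omega>" "AE \<omega> in M. S \<omega> \<le> \<tau>\<^sub>2 \<omega>"
      using t by (simp_all add: bermudan_from_def)
    then have "AE \<omega> in M. S \<omega> \<le> min (\<tau>\<^sub>1 \<omega>) (\<tau>\<^sub>2 \<omega>)"
      by eventually_elim simp
    with m have "\<tau>\<^sub>1 \<sqinter>\<^sub>t \<tau>\<^sub>2 \<in> \<Theta>_from S"
      by (simp add: bermudan_from_def)
    then have "\<rho> S (\<tau>\<^sub>1 \<sqinter>\<^sub>t \<tau>\<^sub>2) (\<lambda>\<omega>. real_of_ereal (\<phi> (\<tau>\<^sub>1 \<sqinter>\<^sub>t \<tau>\<^sub>2) \<omega>)) \<in> ?U"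
      by blast
    from ess_sup_upper[OF U this] rho_reward_le_rho_new_reward[OF S t fin[OF m] Lp[OF m]]
    show "AE \<omega> in M. ereal (x \<omega>) \<le> ess_sup M ?U \<omega>"
      unfolding x by eventually_elim (meson ereal_less_eq(3) order.trans)
  qed
  ultimately show "AE \<omega> in M. single_value M F T \<theta> \<rho> \<psi> S \<omega> = double_value M F T \<theta> \<rho> \<psi> S \<omega>"
    unfolding single_value_def by eventually_elim (rule order.antisym)
qed

end
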